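(* Let $p$ be a prime and let $\{m_n\}_{n\ge1}$ be a strictly increasing sequence of integers with $\limsup_{n\to\infty}(m_{n+1}-m_n)=+\infty$. Let $\Omega\subset\mathbb{Q}_p$ be the open set $$\Omega=\bigcup_{n=1}^\infty\left(p^{m_n-1}+p^{m_n}\mathbb{Z}_p\right).$$ Then no set of continuous additive characters of $\mathbb{Q}_p$ forms a Riesz basis of $L^2(\Omega)$.
   Context: $\mathbb{Q}_p$ is the field of $p$-adic numbers and $\mathbb{Z}_p$ the ring of $p$-adic integers. A continuous additive character of $\mathbb{Q}_p$ is a continuous group homomorphism from $(\mathbb{Q}_p,+)$ to $\mathbb{T}=\{z\in\mathbb{C}:|z|=1\}$. $L^2(\Omega)$ is taken with respect to Haar measure restricted to $\Omega$, and characters are viewed as elements of $L^2(\Omega)$ by restriction. A countable family $\{f_n\}$ in a separable Hilbert space $\mathcal{H}$ is a Riesz basis if $f_n=Te_n$ for all $n$, for some bounded invertible operator $T:\mathcal{H}\to\mathcal{H}$ and some orthonormal basis $\{e_n\}$ of $\mathcal{H}$; equivalently, $\{f_n\}$ is complete in $\mathcal{H}$ and there is $K>0$ with $\frac1K\sum_n|a_n|^2\le\|\sum_n a_nf_n\|^2\le K\sum_n|a_n|^2$ for all square-summable $\{a_n\}\subset\mathbb{C}$. *)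

theory Defs
  imports "HOL-Analysis.Analysis" "Berlekamp_Zassenhaus.Finite_Field"
begin

section \<open>The p-adic absolute value on the rationals\<close>

definition pabs :: "nat \<Rightarrow> rat \<Rightarrow> real" where
  "pabs p q = (if q = 0 then 0
     else case quotient_of q of (a, b) \<Rightarrow>
       real p powi (int (multiplicity (int p) b) - int (multiplicity (int p) a)))"

lemma pabs_0 [simp]: "pabs p 0 = 0"
  by (simp add: pabs_def)

lemma pabs_of_int_divide:
  assumes p: "prime p" and a: "a \<noteq> 0" and b: "b \<noteq> 0"
  shows "pabs p (of_int a / of_int b) =
    real p powi (int (multiplicity (int p) b) - int (multiplicity (int p) a))"
proof -
  let ?q = "of_int a / of_int b :: rat"
  obtain c d where cd: "quotient_of ?q = (c, d)" by (cases "quotient_of ?q")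
  have d: "d > 0" using quotient_of_denom_pos[OF cd] .
  have q: "?q = of_int c / of_int d" using quotient_of_div[OF cd] .
  have q0: "?q \<noteq> 0" using a b by simp
  hence c: "c \<noteq> 0" using q by auto
  have "of_int a * of_int d = (of_int c * of_int b :: rat)"
    using q b d by (simp add: field_simps)
  hence eq: "a * d = c * b" by (simp only: of_int_mult [symmetric] of_int_eq_iff)
  have pe: "prime_elem (int p)" using p by simp
  have "multiplicity (int p) a + multiplicity (int p) d = multiplicity (int p) c + multiplicity (int p) b"
    using arg_cong[OF eq, of "multiplicity (int p)"] a b c d
    by (simp add: prime_elem_multiplicity_mult_distrib[OF pe])
  hence "int (multiplicity (int p) b) - int (multiplicity (int p) a) =
         int (multiplicity (int p) d) - int (multiplicity (int p) c)" by linarith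
  thus ?thesis unfolding pabs_def using q0 cd by simp
qed

lemma rat_cases_int:
  obtains a b where "(q::rat) = of_int a / of_int b" "b \<noteq> 0"
  using quotient_of_div[of q] quotient_of_denom_pos[of q]
  by (metis less_irrefl surj_pair)

lemma pabs_pos:
  assumes "prime p" "q \<noteq> 0" shows "pabs p q > 0"
proof -
  have "real p > 0" using assms(1) prime_gt_0_nat by simp
  thus ?thesis using assms(2) unfolding pabs_def by (auto split: prod.split)
qed

lemma pabs_eq_0_iff: "prime p \<Longrightarrow> pabs p q = 0 \<longleftrightarrow> q = 0"
  using pabs_pos[of p q] by (metis less_irrefl pabs_0)

lemma pabs_nonneg: "prime p \<Longrightarrow> pabs p q \<ge> 0"
  using pabs_pos[of p q] by (cases "q = 0") (auto simp: less_imp_le)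

lemma pabs_1 [simp]: "pabs p 1 = 1"
  by (simp add: pabs_def)

lemma pabs_mult:
  assumes p: "prime p" shows "pabs p (x * y) = pabs p x * pabs p y"
proof (cases "x = 0 \<or> y = 0")
  case False
  obtain a b where x: "x = of_int a / of_int b" "b \<noteq> 0" by (rule rat_cases_int)
  obtain c d where y: "y = of_int c / of_int d" "d \<noteq> 0" by (rule rat_cases_int)
  have ac: "a \<noteq> 0" "c \<noteq> 0" using False x y by auto
  have xy: "x * y = of_int (a * c) / of_int (b * d)" using x y by simp
  have pe: "prime_elem (int p)" using p by simp
  have p0: "real p \<noteq> 0" using p prime_gt_0_nat by simp
  have "pabs p (x * y) = real p powi (int (multiplicity (int p) (b * d)) - int (multiplicity (int p) (a * c)))"
    unfolding xy using ac x y by (intro pabs_of_int_divide[OF p]) auto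
  also have "int (multiplicity (int p) (b * d)) - int (multiplicity (int p) (a * c)) =
     (int (multiplicity (int p) b) - int (multiplicity (int p) a)) +
     (int (multiplicity (int p) d) - int (multiplicity (int p) c))"
    using ac x y by (simp add: prime_elem_multiplicity_mult_distrib[OF pe])
  finally show ?thesis
    unfolding x(1) y(1) using ac x y p0
    by (simp add: pabs_of_int_divide[OF p] power_int_add del: of_int_mult)
qed auto

lemma pabs_add_le_max:
  assumes p: "prime p" shows "pabs p (x + y) \<le> max (pabs p x) (pabs p y)"
proof (cases "x = 0 \<or> y = 0 \<or> x + y = 0")
  case True
  thus ?thesis using pabs_nonneg[OF p, of x] pabs_nonneg[OF p, of y] by auto
next
  case False
  let ?v = "\<lambda>k. int (multiplicity (int p) k)"
  obtain a b where x: "x = of_int a / of_int b" "b \<noteq> 0" by (rule rat_cases_int)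
  obtain c d where y: "y = of_int c / of_int d" "d \<noteq> 0" by (rule rat_cases_int)
  have ac: "a \<noteq> 0" "c \<noteq> 0" using False x y by auto
  have xy: "x + y = of_int (a * d + c * b) / of_int (b * d)"
    using x y by (simp add: field_simps)
  have nz: "a * d + c * b \<noteq> 0" using False xy by (metis div_0 of_int_0)
  have pe: "prime_elem (int p)" using p by simp
  have p1: "real p \<ge> 1" using p prime_ge_1_nat by simp
  have nu: "\<not> is_unit (int p)" using pe unfolding prime_elem_def by blast
  let ?k = "min (multiplicity (int p) (a * d)) (multiplicity (int p) (c * b))"
  have "int p ^ ?k dvd a * d" "int p ^ ?k dvd c * b"
    by (rule multiplicity_dvd', simp)+
  hence "int p ^ ?k dvd a * d + c * b" by (rule dvd_add)
  hence le: "?k \<le> multiplicity (int p) (a * d + c * b)"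
    using nz nu by (intro multiplicity_geI) auto
  have e: "?v (a * d) = ?v a + ?v d" "?v (c * b) = ?v c + ?v b" "?v (b * d) = ?v b + ?v d"
    using ac x y by (simp_all add: prime_elem_multiplicity_mult_distrib[OF pe])
  have "?v (b * d) - ?v (a * d + c * b) \<le> ?v b - ?v a \<or> ?v (b * d) - ?v (a * d + c * b) \<le> ?v d - ?v c"
    using le e by linarith
  moreover have "pabs p (x + y) = real p powi (?v (b * d) - ?v (a * d + c * b))"
    unfolding xy using nz x y by (intro pabs_of_int_divide[OF p]) auto
  moreover have "pabs p x = real p powi (?v b - ?v a)"
    unfolding x(1) using ac x by (intro pabs_of_int_divide[OF p]) auto
  moreover have "pabs p y = real p powi (?v d - ?v c)"
    unfolding y(1) using ac y by (intro pabs_of_int_divide[OF p]) auto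
  ultimately show ?thesis
    using power_int_increasing[OF _ p1] by (metis max.coboundedI1 max.coboundedI2)
qed

lemma pabs_minus [simp]: assumes p: "prime p" shows "pabs p (- x) = pabs p x"
proof -
  have "pabs p (-1) * pabs p (-1) = 1" using pabs_mult[OF p, of "-1" "-1"] by simp
  hence "pabs p (-1) = 1" using pabs_nonneg[OF p, of "-1"]
    by (metis abs_of_nonneg abs_square_eq_1 power2_eq_square)
  thus ?thesis using pabs_mult[OF p, of "-1" x] by simp
qed

lemma pabs_add: "prime p \<Longrightarrow> pabs p (x + y) \<le> pabs p x + pabs p y"
  using pabs_add_le_max[of p x y] pabs_nonneg[of p x] pabs_nonneg[of p y] by linarith

lemma pabs_diff_abs:
  assumes p: "prime p" shows "\<bar>pabs p x - pabs p y\<bar> \<le> pabs p (x - y)"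
  using pabs_add[OF p, of "x - y" y] pabs_add[OF p, of "y - x" x] pabs_minus[OF p, of "x - y"]
  by simp

lemma pabs_inverse:
  assumes p: "prime p" shows "pabs p (inverse x) = inverse (pabs p x)"
proof (cases "x = 0")
  case False
  thus ?thesis using pabs_mult[OF p, of x "inverse x"] by (simp add: inverse_unique)
qed simp


section \<open>Cauchy sequences for the p-adic absolute value\<close>

definition pnull :: "nat \<Rightarrow> (nat \<Rightarrow> rat) \<Rightarrow> bool" where
  "pnull p X \<longleftrightarrow> (\<lambda>n. pabs p (X n)) \<longlonglongrightarrow> 0"

definition pcauchy :: "nat \<Rightarrow> (nat \<Rightarrow> rat) \<Rightarrow> bool" where
  "pcauchy p X \<longleftrightarrow> (\<forall>e>0. \<exists>N. \<forall>m\<ge>N. \<forall>n\<ge>N. pabs p (X m - X n) < e)"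

lemma pcauchyD:
  "pcauchy p X \<Longrightarrow> e > 0 \<Longrightarrow> \<exists>N. \<forall>m\<ge>N. \<forall>n\<ge>N. pabs p (X m - X n) < e"
  by (simp add: pcauchy_def)

lemma pcauchy_const [simp]: "pcauchy p (\<lambda>n. c)"
  by (simp add: pcauchy_def)

lemma pnull_0 [simp]: "pnull p (\<lambda>n. 0)"
  by (simp add: pnull_def)

lemma pnull_le:
  assumes p: "prime p" and "eventually (\<lambda>n. pabs p (X n) \<le> g n) sequentially" "g \<longlonglongrightarrow> 0"
  shows "pnull p X"
  unfolding pnull_def
  by (rule tendsto_sandwich[OF _ assms(2) tendsto_const assms(3)])
     (simp add: pabs_nonneg[OF p])

lemma pnull_add:
  assumes p: "prime p" and "pnull p X" "pnull p Y" shows "pnull p (\<lambda>n. X n + Y n)"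
  using assms(2,3) unfolding pnull_def
  by (intro pnull_le[OF p, unfolded pnull_def, of _ "\<lambda>n. pabs p (X n) + pabs p (Y n)"])
     (auto intro!: tendsto_add_zero always_eventually pabs_add[OF p])

lemma pnull_minus:
  assumes p: "prime p" and "pnull p X" shows "pnull p (\<lambda>n. - X n)"
  using assms by (simp add: pnull_def)

lemma pcauchy_add:
  assumes p: "prime p" and X: "pcauchy p X" and Y: "pcauchy p Y"
  shows "pcauchy p (\<lambda>n. X n + Y n)"
  unfolding pcauchy_def
proof (intro allI impI)
  fix e :: real assume e: "e > 0"
  obtain N M where N: "\<forall>m\<ge>N. \<forall>n\<ge>N. pabs p (X m - X n) < e"
    and M: "\<forall>m\<ge>M. \<forall>n\<ge>M. pabs p (Y m - Y n) < e"
    using pcauchyD[OF X e] pcauchyD[OF Y e] by blast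
  have "pabs p ((X m + Y m) - (X n + Y n)) < e" if "m \<ge> max N M" "n \<ge> max N M" for m n
  proof -
    have eq: "(X m + Y m) - (X n + Y n) = (X m - X n) + (Y m - Y n)" by simp
    have "pabs p (X m - X n) < e" "pabs p (Y m - Y n) < e" using N M that by auto
    thus ?thesis unfolding eq
      using pabs_add_le_max[OF p, of "X m - X n" "Y m - Y n"] by linarith
  qed
  thus "\<exists>N. \<forall>m\<ge>N. \<forall>n\<ge>N. pabs p ((X m + Y m) - (X n + Y n)) < e" by blast
qed

lemma pcauchy_minus:
  assumes p: "prime p" and X: "pcauchy p X" shows "pcauchy p (\<lambda>n. - X n)"
proof -
  have "pabs p (- X m - - X n) = pabs p (X m - X n)" for m n
    using pabs_minus[OF p, of "X m - X n"] by simp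
  thus ?thesis using X by (simp add: pcauchy_def)
qed

lemma pcauchy_diff:
  assumes "prime p" "pcauchy p X" "pcauchy p Y" shows "pcauchy p (\<lambda>n. X n - Y n)"
  using pcauchy_add[OF assms(1,2) pcauchy_minus[OF assms(1,3)]] by simp

lemma pcauchy_convergent_pabs:
  assumes p: "prime p" and X: "pcauchy p X" shows "convergent (\<lambda>n. pabs p (X n))"
proof -
  have "Cauchy (\<lambda>n. pabs p (X n))"
    unfolding Cauchy_def dist_real_def
    using pcauchyD[OF X] pabs_diff_abs[OF p] by (meson order_le_less_trans)
  thus ?thesis by (simp add: Cauchy_convergent_iff)
qed

lemma pcauchy_bounded:
  assumes p: "prime p" and X: "pcauchy p X"
  obtains B where "B > 0" "\<And>n. pabs p (X n) \<le> B"
proof -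
  have "Bseq (\<lambda>n. pabs p (X n))"
    using convergent_imp_Bseq[OF pcauchy_convergent_pabs[OF p X]] .
  then obtain B where "B > 0" "\<forall>n. norm (pabs p (X n)) \<le> B" by (auto simp: Bseq_def)
  thus ?thesis using that[of B] pabs_nonneg[OF p] by simp
qed

lemma pcauchy_mult:
  assumes p: "prime p" and X: "pcauchy p X" and Y: "pcauchy p Y"
  shows "pcauchy p (\<lambda>n. X n * Y n)"
  unfolding pcauchy_def
proof (intro allI impI)
  fix e :: real assume e: "e > 0"
  obtain A where A: "A > 0" "\<And>n. pabs p (X n) \<le> A" by (rule pcauchy_bounded[OF p X]) blast
  obtain B where B: "B > 0" "\<And>n. pabs p (Y n) \<le> B" by (rule pcauchy_bounded[OF p Y]) blast
  obtain N M where N: "\<forall>m\<ge>N. \<forall>n\<ge>N. pabs p (X m - X n) < e / B"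
    and M: "\<forall>m\<ge>M. \<forall>n\<ge>M. pabs p (Y m - Y n) < e / A"
    using pcauchyD[OF X, of "e / B"] pcauchyD[OF Y, of "e / A"] e A(1) B(1)
    by (auto simp del: less_divide_eq_1_pos)
  have "pabs p (X m * Y m - X n * Y n) < e" if "m \<ge> max N M" "n \<ge> max N M" for m n
  proof -
    have eq: "X m * Y m - X n * Y n = X m * (Y m - Y n) + (X m - X n) * Y n"
      by (simp add: algebra_simps)
    have "pabs p (X m * (Y m - Y n)) \<le> A * pabs p (Y m - Y n)"
      unfolding pabs_mult[OF p] by (intro mult_right_mono A pabs_nonneg[OF p])
    also have "\<dots> < A * (e / A)" using M that A(1) by (intro mult_strict_left_mono) auto
    finally have 1: "pabs p (X m * (Y m - Y n)) < e" using A(1) by simp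
    have "pabs p ((X m - X n) * Y n) \<le> pabs p (X m - X n) * B"
      unfolding pabs_mult[OF p] by (intro mult_left_mono B pabs_nonneg[OF p])
    also have "\<dots> < (e / B) * B" using N that B(1) by (intro mult_strict_right_mono) auto
    finally have 2: "pabs p ((X m - X n) * Y n) < e" using B(1) by simp
    show ?thesis unfolding eq
      using 1 2 pabs_add_le_max[OF p, of "X m * (Y m - Y n)" "(X m - X n) * Y n"] by simp
  qed
  thus "\<exists>N. \<forall>m\<ge>N. \<forall>n\<ge>N. pabs p (X m * Y m - X n * Y n) < e" by blast
qed

lemma pnull_mult_bounded:
  assumes p: "prime p" and X: "pnull p X" and Y: "pcauchy p Y"
  shows "pnull p (\<lambda>n. X n * Y n)"
proof -
  obtain B where B: "B > 0" "\<And>n. pabs p (Y n) \<le> B" by (rule pcauchy_bounded[OF p Y]) blast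
  show ?thesis
  proof (rule pnull_le[OF p])
    show "eventually (\<lambda>n. pabs p (X n * Y n) \<le> pabs p (X n) * B) sequentially"
      unfolding pabs_mult[OF p]
      by (intro always_eventually allI mult_left_mono B pabs_nonneg[OF p])
    show "(\<lambda>n. pabs p (X n) * B) \<longlonglongrightarrow> 0"
      using X unfolding pnull_def by (rule tendsto_mult_left_zero)
  qed
qed

lemma pcauchy_not_pnull:
  assumes p: "prime p" and X: "pcauchy p X" and nz: "\<not> pnull p X"
  obtains b N where "b > 0" "\<And>n. n \<ge> N \<Longrightarrow> pabs p (X n) > b"
proof -
  obtain L where L: "(\<lambda>n. pabs p (X n)) \<longlonglongrightarrow> L"
    using pcauchy_convergent_pabs[OF p X] by (auto simp: convergent_def)
  have "L \<ge> 0" by (rule LIMSEQ_le_const[OF L]) (simp add: pabs_nonneg[OF p])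
  moreover have "L \<noteq> 0" using nz L by (auto simp: pnull_def)
  ultimately have "L > 0" by simp
  hence "eventually (\<lambda>n. pabs p (X n) > L / 2) sequentially"
    by (intro order_tendstoD(1)[OF L]) simp
  thus ?thesis using that[of "L / 2"] \<open>L > 0\<close> by (auto simp: eventually_sequentially)
qed

lemma pcauchy_inverse:
  assumes p: "prime p" and X: "pcauchy p X" and nz: "\<not> pnull p X"
  shows "pcauchy p (\<lambda>n. inverse (X n))"
  unfolding pcauchy_def
proof (intro allI impI)
  fix e :: real assume e: "e > 0"
  obtain b N where b: "b > 0" "\<And>n. n \<ge> N \<Longrightarrow> pabs p (X n) > b"
    by (rule pcauchy_not_pnull[OF assms]) blast
  obtain M where M: "\<forall>m\<ge>M. \<forall>n\<ge>M. pabs p (X m - X n) < e * (b * b)"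
    using pcauchyD[OF X, of "e * (b * b)"] e b(1) by auto
  have "pabs p (inverse (X m) - inverse (X n)) < e" if "m \<ge> max N M" "n \<ge> max N M" for m n
  proof -
    have bm: "pabs p (X m) > b" "pabs p (X n) > b" using b that by auto
    hence nz: "X m \<noteq> 0" "X n \<noteq> 0" using b(1) by auto
    have eq: "(inverse (X m) - inverse (X n)) * (X m * X n) = X n - X m"
      using nz by (simp add: field_simps)
    have "pabs p (inverse (X m) - inverse (X n)) * (b * b)
        \<le> pabs p (inverse (X m) - inverse (X n)) * (pabs p (X m) * pabs p (X n))"
      using bm b(1) by (intro mult_left_mono mult_mono pabs_nonneg[OF p]) auto
    also have "\<dots> = pabs p (X n - X m)"
      by (simp only: pabs_mult[OF p, symmetric] eq)
    also have "\<dots> < e * (b * b)" using M that by auto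
    finally show ?thesis using b(1) by simp
  qed
  thus "\<exists>N. \<forall>m\<ge>N. \<forall>n\<ge>N. pabs p (inverse (X m) - inverse (X n)) < e" by blast
qed

lemma pnull_diff_inverse:
  assumes p: "prime p" and X: "pcauchy p X" "\<not> pnull p X" and Y: "pcauchy p Y" "\<not> pnull p Y"
    and XY: "pnull p (\<lambda>n. X n - Y n)"
  shows "pnull p (\<lambda>n. inverse (X n) - inverse (Y n))"
proof -
  obtain b N where b: "b > 0" "\<And>n. n \<ge> N \<Longrightarrow> pabs p (X n) > b"
    by (rule pcauchy_not_pnull[OF p X]) blast
  obtain c M where c: "c > 0" "\<And>n. n \<ge> M \<Longrightarrow> pabs p (Y n) > c"
    by (rule pcauchy_not_pnull[OF p Y]) blast
  have C: "pcauchy p (\<lambda>n. - (inverse (X n) * inverse (Y n)))"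
    by (intro pcauchy_minus[OF p] pcauchy_mult[OF p] pcauchy_inverse[OF p] X Y)
  have "pnull p (\<lambda>n. (X n - Y n) * (- (inverse (X n) * inverse (Y n))))"
    by (rule pnull_mult_bounded[OF p XY C])
  moreover have "eventually (\<lambda>n. pabs p ((X n - Y n) * (- (inverse (X n) * inverse (Y n))))
      = pabs p (inverse (X n) - inverse (Y n))) sequentially"
    unfolding eventually_sequentially
  proof (intro exI allI impI)
    fix n assume "n \<ge> max N M"
    hence "pabs p (X n) > b" "pabs p (Y n) > c" using b c by auto
    hence "X n \<noteq> 0" "Y n \<noteq> 0" using b(1) c(1) by auto
    hence "(X n - Y n) * (- (inverse (X n) * inverse (Y n))) = inverse (X n) - inverse (Y n)"
      by (simp add: field_simps)
    thus "pabs p ((X n - Y n) * (- (inverse (X n) * inverse (Y n))))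
      = pabs p (inverse (X n) - inverse (Y n))" by simp
  qed
  ultimately show ?thesis unfolding pnull_def by (rule Lim_transform_eventually)
qed


section \<open>The field of p-adic numbers\<close>

text \<open>The prime \<open>p\<close> is carried by a type parameter \<open>'p\<close> of prime cardinality,
  \<open>p = CARD('p)\<close>; \<open>'p padic\<close> is the completion of the rationals for the
  \<open>p\<close>-adic absolute value.\<close>

definition padicrel :: "'p::prime_card itself \<Rightarrow> (nat \<Rightarrow> rat) \<Rightarrow> (nat \<Rightarrow> rat) \<Rightarrow> bool" where
  "padicrel _ X Y \<longleftrightarrow> pcauchy CARD('p) X \<and> pcauchy CARD('p) Y \<and> pnull CARD('p) (\<lambda>n. X n - Y n)"

lemma part_equivp_padicrel: "part_equivp (padicrel TYPE('p::prime_card))"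
proof (rule part_equivpI)
  note p = prime_card[where 'a='p]
  show "\<exists>x. padicrel TYPE('p) x x" by (rule exI[of _ "\<lambda>n. 0"]) (simp add: padicrel_def)
  show "symp (padicrel TYPE('p))"
    using pnull_minus[OF p] by (fastforce simp: padicrel_def symp_def)
  show "transp (padicrel TYPE('p))"
  proof (rule transpI)
    fix X Y Z assume "padicrel TYPE('p) X Y" "padicrel TYPE('p) Y Z"
    thus "padicrel TYPE('p) X Z"
      using pnull_add[OF p, of "\<lambda>n. X n - Y n" "\<lambda>n. Y n - Z n"] by (simp add: padicrel_def)
  qed
qed

typedef ('p::prime_card) padic =
    "{C. \<exists>X. padicrel TYPE('p) X X \<and> C = Collect (padicrel TYPE('p) X)}"
  morphisms padic_class Abs_padic_class
  by (rule exI[of _ "Collect (padicrel TYPE('p) (\<lambda>n. 0))"], simp add: padicrel_def)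
    (rule exI[of _ "\<lambda>n. 0"], simp)

definition padic_of_seq :: "(nat \<Rightarrow> rat) \<Rightarrow> 'p::prime_card padic" where
  "padic_of_seq X = Abs_padic_class (Collect (padicrel TYPE('p) X))"

definition rep_padic :: "'p::prime_card padic \<Rightarrow> nat \<Rightarrow> rat" where
  "rep_padic x = (SOME X. X \<in> padic_class x)"

definition cr_padic :: "(nat \<Rightarrow> rat) \<Rightarrow> 'p::prime_card padic \<Rightarrow> bool" where
  "cr_padic X x \<longleftrightarrow> padicrel TYPE('p) X X \<and> padic_of_seq X = x"

lemma quot_type_padic:
  "quot_type (padicrel TYPE('p)) (Abs_padic_class :: _ \<Rightarrow> 'p::prime_card padic) padic_class"
proof (rule quot_type.intro)
  show "part_equivp (padicrel TYPE('p))" by (rule part_equivp_padicrel)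
  show "\<exists>x. padicrel TYPE('p) x x \<and> padic_class y = Collect (padicrel TYPE('p) x)"
    for y :: "'p padic"
    using padic_class[of y] by blast
  show "Abs_padic_class (padic_class x) = x" for x :: "'p padic"
    by (rule padic_class_inverse)
  show "padic_class (Abs_padic_class c :: 'p padic) = c"
    if "\<exists>x. padicrel TYPE('p) x x \<and> c = Collect (padicrel TYPE('p) x)" for c
    using that by (intro Abs_padic_class_inverse) blast
  show "(padic_class x = padic_class y) = (x = y)" for x y :: "'p padic"
    by (rule padic_class_inject)
qed

lemma Quotient_padic:
  "Quotient (padicrel TYPE('p)) padic_of_seq (rep_padic :: 'p::prime_card padic \<Rightarrow> _) cr_padic"
proof -
  note q = quot_type_padic[where 'p='p]
  have a: "quot_type.abs (padicrel TYPE('p)) Abs_padic_class = (padic_of_seq :: _ \<Rightarrow> 'p padic)"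
    by (simp add: fun_eq_iff quot_type.abs_def[OF q] padic_of_seq_def)
  have r: "quot_type.rep padic_class = (rep_padic :: 'p padic \<Rightarrow> _)"
    by (simp add: fun_eq_iff quot_type.rep_def[OF q] rep_padic_def)
  show ?thesis
    by (rule Quotient3_to_Quotient[OF quot_type.Quotient[OF q, unfolded a r]])
      (rule eq_reflection, simp add: fun_eq_iff cr_padic_def)
qed

setup_lifting Quotient_padic

instantiation padic :: (prime_card) field
begin

lift_definition zero_padic :: "'a padic" is "\<lambda>n. 0"
  by (simp add: padicrel_def)

lift_definition one_padic :: "'a padic" is "\<lambda>n. 1"
  by (simp add: padicrel_def)

lift_definition plus_padic :: "'a padic \<Rightarrow> 'a padic \<Rightarrow> 'a padic" is "\<lambda>X Y n. X n + Y n"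
  unfolding padicrel_def add_diff_add
  by (simp add: pcauchy_add[OF prime_card] pnull_add[OF prime_card])

lift_definition uminus_padic :: "'a padic \<Rightarrow> 'a padic" is "\<lambda>X n. - X n"
  unfolding padicrel_def minus_diff_minus
  by (elim conjE, intro conjI pcauchy_minus[OF prime_card] pnull_minus[OF prime_card]) assumption+

lift_definition minus_padic :: "'a padic \<Rightarrow> 'a padic \<Rightarrow> 'a padic" is "\<lambda>X Y n. X n - Y n"
proof -
  note p = prime_card[where 'a='a]
  fix X X' Y Y' assume "padicrel TYPE('a) X X'" "padicrel TYPE('a) Y Y'"
  thus "padicrel TYPE('a) (\<lambda>n. X n - Y n) (\<lambda>n. X' n - Y' n)"
    using pnull_add[OF p, of "\<lambda>n. X n - X' n" "\<lambda>n. - (Y n - Y' n)"]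
      pnull_minus[OF p, of "\<lambda>n. Y n - Y' n"]
    by (simp add: padicrel_def pcauchy_diff[OF p] algebra_simps)
qed

lift_definition times_padic :: "'a padic \<Rightarrow> 'a padic \<Rightarrow> 'a padic" is "\<lambda>X Y n. X n * Y n"
proof -
  note p = prime_card[where 'a='a]
  fix X X' Y Y' assume *: "padicrel TYPE('a) X X'" "padicrel TYPE('a) Y Y'"
  have "pnull CARD('a) (\<lambda>n. (X n - X' n) * Y n + (Y n - Y' n) * X' n)"
    using * by (intro pnull_add[OF p] pnull_mult_bounded[OF p]) (simp_all add: padicrel_def)
  moreover have "(\<lambda>n. (X n - X' n) * Y n + (Y n - Y' n) * X' n) = (\<lambda>n. X n * Y n - X' n * Y' n)"
    by (simp add: algebra_simps)
  ultimately show "padicrel TYPE('a) (\<lambda>n. X n * Y n) (\<lambda>n. X' n * Y' n)"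
    using * by (simp add: padicrel_def pcauchy_mult[OF p])
qed

lift_definition inverse_padic :: "'a padic \<Rightarrow> 'a padic"
  is "\<lambda>X. if pnull CARD('a) X then (\<lambda>n. 0) else (\<lambda>n. inverse (X n))"
proof -
  note p = prime_card[where 'a='a]
  fix X Y assume *: "padicrel TYPE('a) X Y"
  have "pnull CARD('a) X \<longleftrightarrow> pnull CARD('a) Y"
  proof
    assume "pnull CARD('a) X"
    thus "pnull CARD('a) Y"
      using * pnull_add[OF p, of X "\<lambda>n. - (X n - Y n)"] pnull_minus[OF p, of "\<lambda>n. X n - Y n"]
      by (simp add: padicrel_def)
  next
    assume "pnull CARD('a) Y"
    thus "pnull CARD('a) X"
      using * pnull_add[OF p, of Y "\<lambda>n. X n - Y n"] by (simp add: padicrel_def)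
  qed
  thus "padicrel TYPE('a) (if pnull CARD('a) X then (\<lambda>n. 0) else (\<lambda>n. inverse (X n)))
          (if pnull CARD('a) Y then (\<lambda>n. 0) else (\<lambda>n. inverse (Y n)))"
    using * by (simp add: padicrel_def pcauchy_inverse[OF p] pnull_diff_inverse[OF p])
qed

definition "x div y = x * inverse y" for x y :: "'a padic"

instance
proof
  note p = prime_card[where 'a='a]
  fix a b c :: "'a padic"
  have refl: "padicrel TYPE('a) X X" if "pcauchy CARD('a) X" for X
    using that by (simp add: padicrel_def)
  show "a * b * c = a * (b * c)"
    by transfer (simp add: padicrel_def pcauchy_mult[OF p] mult.assoc)
  show "a * b = b * a"
    by transfer (simp add: padicrel_def pcauchy_mult[OF p] mult.commute)
  show "1 * a = a" by transfer (simp add: padicrel_def)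
  show "a + b + c = a + (b + c)"
    by transfer (simp add: padicrel_def pcauchy_add[OF p] add.assoc)
  show "a + b = b + a"
    by transfer (simp add: padicrel_def pcauchy_add[OF p] add.commute)
  show "0 + a = a" by transfer (simp add: padicrel_def)
  show "- a + a = 0" by transfer (simp add: padicrel_def)
  show "a - b = a + - b"
    by transfer (simp add: padicrel_def pcauchy_diff[OF p])
  show "(a + b) * c = a * c + b * c"
    by transfer (simp add: padicrel_def pcauchy_add[OF p] pcauchy_mult[OF p] distrib_right)
  show "(0::'a padic) \<noteq> 1"
    by transfer (simp add: padicrel_def pnull_def pabs_minus[OF p] LIMSEQ_const_iff)
  show "a div b = a * inverse b" by (rule divide_padic_def)
  show "inverse (0::'a padic) = 0" by transfer (simp add: padicrel_def)
  show "inverse a * a = 1" if "a \<noteq> 0"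
    using that
  proof transfer
    fix X assume X: "padicrel TYPE('a) X X" "\<not> padicrel TYPE('a) X (\<lambda>n. 0)"
    hence C: "pcauchy CARD('a) X" and N: "\<not> pnull CARD('a) X" by (auto simp: padicrel_def)
    obtain b N where b: "b > 0" "\<And>n. n \<ge> N \<Longrightarrow> pabs CARD('a) (X n) > b"
      by (rule pcauchy_not_pnull[OF p C N]) blast
    have "X n \<noteq> 0" if "n \<ge> N" for n using b(2)[OF that] b(1) by auto
    hence "eventually (\<lambda>n. 0 = pabs CARD('a) (inverse (X n) * X n - 1)) sequentially"
      unfolding eventually_sequentially by (intro exI[of _ N]) auto
    hence "pnull CARD('a) (\<lambda>n. inverse (X n) * X n - 1)"
      unfolding pnull_def by (rule Lim_transform_eventually[OF tendsto_const])
    thus "padicrel TYPE('a)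
        (\<lambda>n. (if pnull CARD('a) X then \<lambda>n. 0 else (\<lambda>n. inverse (X n))) n * X n) (\<lambda>n. 1)"
      using C N by (simp add: padicrel_def pcauchy_mult[OF p] pcauchy_inverse[OF p])
  qed
qed

end

lift_definition padic_norm :: "'p::prime_card padic \<Rightarrow> real"
  is "\<lambda>X. lim (\<lambda>n. pabs CARD('p) (X n))"
proof -
  note p = prime_card[where 'a='p]
  fix X Y assume *: "padicrel TYPE('p) X Y"
  obtain L where L: "(\<lambda>n. pabs CARD('p) (X n)) \<longlonglongrightarrow> L"
    using * pcauchy_convergent_pabs[OF p] by (auto simp: padicrel_def convergent_def)
  have "(\<lambda>n. pabs CARD('p) (Y n) - pabs CARD('p) (X n)) \<longlonglongrightarrow> 0"
  proof (rule Lim_null_comparison)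
    show "eventually (\<lambda>n. norm (pabs CARD('p) (Y n) - pabs CARD('p) (X n))
        \<le> pabs CARD('p) (X n - Y n)) sequentially"
      using pabs_diff_abs[OF p] by (simp add: abs_minus_commute)
    show "(\<lambda>n. pabs CARD('p) (X n - Y n)) \<longlonglongrightarrow> 0" using * by (simp add: padicrel_def pnull_def)
  qed
  hence "(\<lambda>n. pabs CARD('p) (Y n)) \<longlonglongrightarrow> L" using tendsto_add[OF _ L] by fastforce
  thus "lim (\<lambda>n. pabs CARD('p) (X n)) = lim (\<lambda>n. pabs CARD('p) (Y n))" using L limI by metis
qed

lemma pcauchy_lim:
  assumes p: "prime p" and X: "pcauchy p X"
  shows "(\<lambda>n. pabs p (X n)) \<longlonglongrightarrow> lim (\<lambda>n. pabs p (X n))"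
  using pcauchy_convergent_pabs[OF assms] by (simp add: convergent_LIMSEQ_iff)

lemma padic_norm_eq_0_iff [simp]: "padic_norm x = 0 \<longleftrightarrow> x = 0" for x :: "'p::prime_card padic"
proof transfer
  note p = prime_card[where 'a='p]
  fix X assume X: "padicrel TYPE('p) X X"
  have L: "(\<lambda>n. pabs CARD('p) (X n)) \<longlonglongrightarrow> lim (\<lambda>n. pabs CARD('p) (X n))"
    using X by (intro pcauchy_lim[OF p]) (simp add: padicrel_def)
  hence "lim (\<lambda>n. pabs CARD('p) (X n)) = 0 \<longleftrightarrow> pnull CARD('p) X"
    unfolding pnull_def using LIMSEQ_unique by metis
  thus "lim (\<lambda>n. pabs CARD('p) (X n)) = 0 \<longleftrightarrow> padicrel TYPE('p) X (\<lambda>n. 0)"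
    using X by (simp add: padicrel_def)
qed

lemma padic_norm_0 [simp]: "padic_norm (0 :: 'p::prime_card padic) = 0"
  by simp

lemma padic_norm_ultra:
  "padic_norm (x + y) \<le> max (padic_norm x) (padic_norm y)" for x y :: "'p::prime_card padic"
proof transfer
  note p = prime_card[where 'a='p]
  fix X Y assume "padicrel TYPE('p) X X" "padicrel TYPE('p) Y Y"
  hence C: "pcauchy CARD('p) X" "pcauchy CARD('p) Y" by (auto simp: padicrel_def)
  show "lim (\<lambda>n. pabs CARD('p) (X n + Y n))
      \<le> max (lim (\<lambda>n. pabs CARD('p) (X n))) (lim (\<lambda>n. pabs CARD('p) (Y n)))"
  proof (rule LIMSEQ_le)
    show "(\<lambda>n. pabs CARD('p) (X n + Y n)) \<longlonglongrightarrow> lim (\<lambda>n. pabs CARD('p) (X n + Y n))"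
      by (intro pcauchy_lim[OF p] pcauchy_add[OF p] C)
    show "(\<lambda>n. max (pabs CARD('p) (X n)) (pabs CARD('p) (Y n))) \<longlonglongrightarrow>
        max (lim (\<lambda>n. pabs CARD('p) (X n))) (lim (\<lambda>n. pabs CARD('p) (Y n)))"
      by (intro tendsto_max pcauchy_lim[OF p] C)
  qed (use pabs_add_le_max[OF p] in blast)
qed

lemma padic_norm_minus [simp]: "padic_norm (- x) = padic_norm x" for x :: "'p::prime_card padic"
  by transfer (simp add: prime_card)

lemma padic_norm_mult:
  "padic_norm (x * y) = padic_norm x * padic_norm y" for x y :: "'p::prime_card padic"
proof transfer
  note p = prime_card[where 'a='p]
  fix X Y assume "padicrel TYPE('p) X X" "padicrel TYPE('p) Y Y"
  hence C: "pcauchy CARD('p) X" "pcauchy CARD('p) Y" by (auto simp: padicrel_def)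
  show "lim (\<lambda>n. pabs CARD('p) (X n * Y n))
      = lim (\<lambda>n. pabs CARD('p) (X n)) * lim (\<lambda>n. pabs CARD('p) (Y n))"
    unfolding pabs_mult[OF p] by (intro limI tendsto_mult pcauchy_lim[OF p] C)
qed

lemma padic_norm_nonneg [simp]: "padic_norm x \<ge> 0" for x :: "'p::prime_card padic"
  using padic_norm_ultra[of x "- x"] by simp

instantiation padic :: (prime_card) metric_space
begin

definition dist_padic :: "'a padic \<Rightarrow> 'a padic \<Rightarrow> real" where
  "dist_padic x y = padic_norm (x - y)"

definition uniformity_padic :: "('a padic \<times> 'a padic) filter" where
  "uniformity_padic = (INF e\<in>{0<..}. principal {(x, y). dist x y < e})"

definition open_padic :: "'a padic set \<Rightarrow> bool" where
  "open_padic U \<longleftrightarrow> (\<forall>x\<in>U. \<forall>\<^sub>F (x', y) in uniformity. x' = x \<longrightarrow> y \<in> U)"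

instance
proof
  fix x y z :: "'a padic"
  show "dist x y = 0 \<longleftrightarrow> x = y" by (simp add: dist_padic_def)
  have "padic_norm (x - y) \<le> max (padic_norm (x - z)) (padic_norm (y - z))"
    using padic_norm_ultra[of "x - z" "- (y - z)"] padic_norm_minus[of "y - z"] by simp
  also have "\<dots> \<le> padic_norm (x - z) + padic_norm (y - z)" by simp
  finally show "dist x y \<le> dist x z + dist y z" by (simp add: dist_padic_def)
qed (simp_all add: uniformity_padic_def open_padic_def)

end

definition padic_integers :: "'p::prime_card padic set" where
  "padic_integers = {x. padic_norm x \<le> 1}"

definition continuous_character :: "('p::prime_card padic \<Rightarrow> complex) \<Rightarrow> bool" where
  "continuous_character \<psi> \<longleftrightarrow>
     continuous_on UNIV \<psi> \<and> (\<forall>x. cmod (\<psi> x) = 1) \<and> (\<forall>x y. \<psi> (x + y) = \<psi> x * \<psi> y)"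

text \<open>Regularity is not demanded: on a locally compact, \<open>\<sigma>\<close>-compact metric group every Borel
  measure that is finite on compact sets is regular.\<close>

definition haar_measure :: "'a::{topological_space, group_add} measure \<Rightarrow> bool" where
  "haar_measure \<mu> \<longleftrightarrow>
     sets \<mu> = sets borel \<and>
     (\<forall>A\<in>sets borel. \<forall>a. emeasure \<mu> ((+) a ` A) = emeasure \<mu> A) \<and>
     (\<forall>K. compact K \<longrightarrow> emeasure \<mu> K < \<infinity>) \<and>
     (\<forall>U. open U \<longrightarrow> U \<noteq> {} \<longrightarrow> emeasure \<mu> U > 0)"


section \<open>Riesz bases of \<open>L\<^sup>2\<close>\<close>

text \<open>Elements of \<open>L\<^sup>2\<close> are represented by square integrable functions; equality in \<open>L\<^sup>2\<close> is
  equality almost everywhere. For \<open>M = restrict_space \<mu> \<Omega>\<close> the values of a function outside \<open>\<Omega>\<close>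
  are irrelevant, so a function on the whole space stands for its restriction to \<open>\<Omega>\<close>.\<close>

definition L2 :: "'a measure \<Rightarrow> ('a \<Rightarrow> complex) set" where
  "L2 M = {f \<in> borel_measurable M. integrable M (\<lambda>x. (cmod (f x))\<^sup>2)}"

definition L2_inner :: "'a measure \<Rightarrow> ('a \<Rightarrow> complex) \<Rightarrow> ('a \<Rightarrow> complex) \<Rightarrow> complex" where
  "L2_inner M f g = (LINT x|M. f x * cnj (g x))"

definition L2_norm :: "'a measure \<Rightarrow> ('a \<Rightarrow> complex) \<Rightarrow> real" where
  "L2_norm M f = sqrt (LINT x|M. (cmod (f x))\<^sup>2)"

definition L2_eq :: "'a measure \<Rightarrow> ('a \<Rightarrow> complex) \<Rightarrow> ('a \<Rightarrow> complex) \<Rightarrow> bool" where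
  "L2_eq M f g \<longleftrightarrow> (AE x in M. f x = g x)"

definition L2_bounded_operator ::
    "'a measure \<Rightarrow> (('a \<Rightarrow> complex) \<Rightarrow> ('a \<Rightarrow> complex)) \<Rightarrow> bool" where
  "L2_bounded_operator M T \<longleftrightarrow>
     (\<forall>f\<in>L2 M. T f \<in> L2 M) \<and>
     (\<forall>f\<in>L2 M. \<forall>g\<in>L2 M. L2_eq M f g \<longrightarrow> L2_eq M (T f) (T g)) \<and>
     (\<forall>f\<in>L2 M. \<forall>g\<in>L2 M. L2_eq M (T (\<lambda>x. f x + g x)) (\<lambda>x. T f x + T g x)) \<and>
     (\<forall>f\<in>L2 M. \<forall>c. L2_eq M (T (\<lambda>x. c * f x)) (\<lambda>x. c * T f x)) \<and>
     (\<exists>C. \<forall>f\<in>L2 M. L2_norm M (T f) \<le> C * L2_norm M f)"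

definition L2_bounded_invertible ::
    "'a measure \<Rightarrow> (('a \<Rightarrow> complex) \<Rightarrow> ('a \<Rightarrow> complex)) \<Rightarrow> bool" where
  "L2_bounded_invertible M T \<longleftrightarrow>
     L2_bounded_operator M T \<and>
     (\<exists>S. L2_bounded_operator M S \<and>
          (\<forall>f\<in>L2 M. L2_eq M (S (T f)) f \<and> L2_eq M (T (S f)) f))"

definition L2_orthonormal_basis :: "'a measure \<Rightarrow> 'i set \<Rightarrow> ('i \<Rightarrow> 'a \<Rightarrow> complex) \<Rightarrow> bool" where
  "L2_orthonormal_basis M I e \<longleftrightarrow>
     (\<forall>i\<in>I. e i \<in> L2 M) \<and>
     (\<forall>i\<in>I. \<forall>j\<in>I. L2_inner M (e i) (e j) = (if i = j then 1 else 0)) \<and>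
     (\<forall>f\<in>L2 M. \<forall>\<epsilon>>0. \<exists>J c. finite J \<and> J \<subseteq> I \<and>
        L2_norm M (\<lambda>x. f x - (\<Sum>j\<in>J. c j * e j x)) < \<epsilon>)"

definition L2_Riesz_basis :: "'a measure \<Rightarrow> 'i set \<Rightarrow> ('i \<Rightarrow> 'a \<Rightarrow> complex) \<Rightarrow> bool" where
  "L2_Riesz_basis M I f \<longleftrightarrow>
     countable I \<and> (\<forall>i\<in>I. f i \<in> L2 M) \<and>
     (\<exists>T e. L2_bounded_invertible M T \<and> L2_orthonormal_basis M I e \<and>
        (\<forall>i\<in>I. L2_eq M (f i) (T (e i))))"

end

theory Submission
  imports Defs
begin

text \<open>
  Write $H_k$ for the ball $p^k \mathbb{Z}_p$, an open compact subgroup of $\mathbb{Q}_p$, and let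
  $U_n$ be the union of the first $n$ of the balls that make up $\Omega$. The argument compares
  two counts of the characters in a hypothetical Riesz basis, one coming from completeness and the
  other from the lower Riesz bound.

  Completeness forces many characters (\<open>Riesz_basis_trivial_characters\<close>). If a subset of $\Omega$
  is a disjoint union of $M$ cosets of $H_l$, then at least $M$ members of the basis are trivial on
  $H_l$. Indeed, a step function on these cosets is automatically orthogonal to each character that
  is nontrivial on $H_l$, and fewer than $M$ further linear conditions leave a nonzero step function
  orthogonal to the whole basis. For $l = m_{n+1}$ the set $U_{n+1}$ is such a union with
  $M = N p^{l-k} + 1$, where $k = m_n$ and $N$ is the number of cosets of $H_k$ in $U_n$: the last
  ball is a single coset of $H_l$, and each of the $N$ cosets splits into $p^{l-k}$ pieces.

  Characters that agree on $H_l$ have at most $p^{l-k}$ different restrictions to $H_k$, so the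
  pigeonhole principle yields $N + 1$ members of the basis with a common restriction to $H_k$
  (\<open>agreeing_characters_pigeonhole\<close>).

  The lower Riesz bound does not tolerate that many when the gap $l - k$ is large. On $U_n$ the
  $N + 1$ characters span a space of dimension at most $N$, so some nontrivial combination
  $\sum_\psi c_\psi \psi$ vanishes on $U_n$ (\<open>dependent_characters_concentrate\<close>). Its squared norm comes from
  $\Omega \setminus U_n \subseteq H_{l-1}$ alone and is at most
  $(N + 1) \, \mu(H_{l-1}) \sum_\psi |c_\psi|^2$. Now $\mu(H_{l-1}) = p^{-(l-k-1)} \mu(H_k)$ and
  $N \mu(H_k) = \mu(U_n)$ is bounded independently of $n$, so the lower Riesz bound gives a
  uniform bound on $p^{l-k-1}$ (\<open>Riesz_basis_shifted_balls_gap_bound\<close>). Unbounded gaps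
  contradict this.

  The compactness of $H_k$, proved from completeness of $\mathbb{Q}_p$ and total boundedness, is what
  makes the Haar measure of a ball finite.
\<close>

section \<open>Linear algebra\<close>

text \<open>
  Gaussian elimination: an equation with a nonzero coefficient expresses one unknown through the
  others, which removes one equation and one unknown.
\<close>

lemma homogeneous_system_nontrivial_solution:
  fixes c :: "'e \<Rightarrow> 'u \<Rightarrow> 'a::field"
  assumes "finite E" "finite U" "card E < card U"
  shows "\<exists>a. (\<exists>u\<in>U. a u \<noteq> 0) \<and> (\<forall>e\<in>E. (\<Sum>u\<in>U. a u * c e u) = 0)"
  using assms
proof (induction E arbitrary: U c rule: finite_induct)
  case empty
  then obtain u where "u \<in> U" by fastforce
  then show ?case by (intro exI[of _ "\<lambda>_. 1"]) auto
next
  case (insert e E)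
  show ?case
  proof (cases "\<forall>u\<in>U. c e u = 0")
    case True
    have "card E < card U" using insert by auto
    then obtain a where a: "\<exists>u\<in>U. a u \<noteq> 0" "\<forall>e\<in>E. (\<Sum>u\<in>U. a u * c e u) = 0"
      using insert.IH[OF insert.prems(1), of c] by blast
    have "(\<Sum>u\<in>U. a u * c e u) = 0" using True by (intro sum.neutral) auto
    with a show ?thesis by (intro exI[of _ a]) blast
  next
    case False
    then obtain v where v: "v \<in> U" "c e v \<noteq> 0" by auto
    define U' where "U' = U - {v}"
    \<comment> \<open>Row \<open>f\<close> after eliminating the unknown \<open>v\<close> with the help of row \<open>e\<close>.\<close>
    define d where "d f u = c f u - c f v / c e v * c e u" for f u
    have U: "U = insert v U'" "v \<notin> U'" "finite U'" using v insert.prems by (auto simp: U'_def)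
    have "card E < card U'" using insert U by auto
    then obtain a where a: "\<exists>u\<in>U'. a u \<noteq> 0" "\<forall>f\<in>E. (\<Sum>u\<in>U'. a u * d f u) = 0"
      using insert.IH[OF U(3), of d] by blast
    define s where "s = (\<Sum>u\<in>U'. a u * c e u)"
    define b where "b = a(v := - s / c e v)"
    have eq: "(\<Sum>u\<in>U. b u * c f u) = - s / c e v * c f v + (\<Sum>u\<in>U'. a u * c f u)" for f
    proof -
      have "(\<Sum>u\<in>U'. b u * c f u) = (\<Sum>u\<in>U'. a u * c f u)"
        using U by (intro sum.cong) (auto simp: b_def)
      thus ?thesis using U by (simp add: b_def)
    qed
    have "(\<Sum>u\<in>U. b u * c f u) = 0" if "f \<in> E" for f
    proof -
      have "0 = (\<Sum>u\<in>U'. a u * c f u - c f v / c e v * (a u * c e u))"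
        using a that by (simp add: d_def right_diff_distrib mult_ac flip: times_divide_eq_right)
      also have "\<dots> = (\<Sum>u\<in>U'. a u * c f u) - c f v / c e v * s"
        by (simp add: sum_subtractf sum_distrib_left s_def)
      finally show ?thesis unfolding eq by (simp add: field_simps)
    qed
    moreover have "(\<Sum>u\<in>U. b u * c e u) = 0"
      unfolding eq using v by (simp add: s_def)
    moreover have "\<exists>u\<in>U. b u \<noteq> 0"
    proof -
      obtain u where "u \<in> U'" "a u \<noteq> 0" using a(1) by blast
      moreover from this U have "u \<noteq> v" by blast
      ultimately show ?thesis using U(1) by (intro bexI[of _ u]) (auto simp: b_def)
    qed
    ultimately show ?thesis by (intro exI[of _ b] conjI ballI) blast+
  qed
qed

section \<open>Riesz bases of \<open>L\<^sup>2\<close>\<close>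

lemma L2_add:
  assumes "f \<in> L2 M" "g \<in> L2 M" shows "(\<lambda>x. f x + g x) \<in> L2 M"
proof -
  have [measurable]: "f \<in> borel_measurable M" "g \<in> borel_measurable M"
    using assms by (auto simp: L2_def)
  have "integrable M (\<lambda>x. (cmod (f x + g x))\<^sup>2)"
  proof (rule Bochner_Integration.integrable_bound)
    show "integrable M (\<lambda>x. 2 * (cmod (f x))\<^sup>2 + 2 * (cmod (g x))\<^sup>2)"
      using assms by (auto simp: L2_def)
    have "(cmod (f x + g x))\<^sup>2 \<le> 2 * (cmod (f x))\<^sup>2 + 2 * (cmod (g x))\<^sup>2" for x
    proof -
      have "(cmod (f x + g x))\<^sup>2 \<le> (cmod (f x) + cmod (g x))\<^sup>2"
        by (intro power_mono norm_triangle_ineq) auto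
      also have "\<dots> \<le> 2 * (cmod (f x))\<^sup>2 + 2 * (cmod (g x))\<^sup>2"
        using sum_squares_bound[of "cmod (f x)" "cmod (g x)"] by (simp add: power2_sum)
      finally show ?thesis .
    qed
    thus "AE x in M. norm ((cmod (f x + g x))\<^sup>2) \<le> norm (2 * (cmod (f x))\<^sup>2 + 2 * (cmod (g x))\<^sup>2)"
      by simp
  qed measurable
  thus ?thesis by (simp add: L2_def)
qed

lemma L2_mult_left: "f \<in> L2 M \<Longrightarrow> (\<lambda>x. c * f x) \<in> L2 M"
  by (auto simp: L2_def norm_mult power_mult_distrib)

lemma L2_sum:
  assumes "\<And>i. i \<in> J \<Longrightarrow> f i \<in> L2 M"
  shows "(\<lambda>x. \<Sum>i\<in>J. c i * f i x) \<in> L2 M"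
  using assms
proof (induction J rule: infinite_finite_induct)
  case (insert i J)
  thus ?case using L2_add[OF L2_mult_left[of "f i" M "c i"], of "\<lambda>x. \<Sum>i\<in>J. c i * f i x"] by simp
qed (auto simp: L2_def)

lemma L2_integrable_mult:
  assumes "f \<in> L2 M" "g \<in> L2 M" shows "integrable M (\<lambda>x. f x * cnj (g x))"
proof (rule Bochner_Integration.integrable_bound)
  have [measurable]: "f \<in> borel_measurable M" "g \<in> borel_measurable M"
    using assms by (auto simp: L2_def)
  show "integrable M (\<lambda>x. (cmod (f x))\<^sup>2 + (cmod (g x))\<^sup>2)" using assms by (auto simp: L2_def)
  have "cmod (f x) * cmod (g x) \<le> (cmod (f x))\<^sup>2 + (cmod (g x))\<^sup>2" for x
    using sum_squares_bound[of "cmod (f x)" "cmod (g x)"]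
      mult_nonneg_nonneg[OF norm_ge_zero[of "f x"] norm_ge_zero[of "g x"]] by linarith
  thus "AE x in M. norm (f x * cnj (g x)) \<le> norm ((cmod (f x))\<^sup>2 + (cmod (g x))\<^sup>2)"
    by (simp add: norm_mult)
  have "(\<lambda>x. cnj (g x)) \<in> borel_measurable M"
    by (intro borel_measurable_continuous_on[of cnj] continuous_intros) simp
  thus "(\<lambda>x. f x * cnj (g x)) \<in> borel_measurable M" by simp
qed

lemma L2_norm_nonneg: "0 \<le> L2_norm M f"
  by (simp add: L2_norm_def)

lemma L2_norm_squared: "(L2_norm M f)\<^sup>2 = (LINT x|M. (cmod (f x))\<^sup>2)"
  by (simp add: L2_norm_def)

lemma L2_norm_squared_eq_inner: "complex_of_real ((L2_norm M f)\<^sup>2) = L2_inner M f f"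
  unfolding L2_norm_squared L2_inner_def
  by (simp add: complex_norm_square[symmetric] del: of_real_power)

lemma L2_inner_sum_right:
  assumes "f \<in> L2 M" "\<And>j. j \<in> J \<Longrightarrow> g j \<in> L2 M"
  shows "L2_inner M f (\<lambda>x. \<Sum>j\<in>J. c j * g j x) = (\<Sum>j\<in>J. cnj (c j) * L2_inner M f (g j))"
proof -
  have "L2_inner M f (\<lambda>x. \<Sum>j\<in>J. c j * g j x) =
      (LINT x|M. (\<Sum>j\<in>J. cnj (c j) * (f x * cnj (g j x))))"
    unfolding L2_inner_def by (simp add: sum_distrib_left algebra_simps)
  also have "\<dots> = (\<Sum>j\<in>J. LINT x|M. cnj (c j) * (f x * cnj (g j x)))"
    using assms by (intro Bochner_Integration.integral_sum integrable_mult_right L2_integrable_mult) auto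
  finally show ?thesis by (simp add: L2_inner_def)
qed

lemma L2_inner_commute: "L2_inner M f g = cnj (L2_inner M g f)"
  using Bochner_Integration.integral_cnj[of M "\<lambda>x. g x * cnj (f x)"] by (simp add: L2_inner_def mult.commute)

lemma L2_norm_add_orthogonal:
  assumes "f \<in> L2 M" "g \<in> L2 M" "L2_inner M f g = 0"
  shows "(L2_norm M (\<lambda>x. f x + g x))\<^sup>2 = (L2_norm M f)\<^sup>2 + (L2_norm M g)\<^sup>2"
proof -
  have fg: "L2_inner M g f = 0" using assms(3) L2_inner_commute[of M g f] by simp
  have "L2_inner M (\<lambda>x. f x + g x) (\<lambda>x. f x + g x) =
     (LINT x|M. (f x * cnj (f x) + f x * cnj (g x)) + (g x * cnj (f x) + g x * cnj (g x)))"
    by (simp add: L2_inner_def algebra_simps)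
  also have "\<dots> = L2_inner M f f + L2_inner M f g + (L2_inner M g f + L2_inner M g g)"
    using assms by (simp add: L2_integrable_mult L2_inner_def)
  finally have "complex_of_real ((L2_norm M (\<lambda>x. f x + g x))\<^sup>2) =
      complex_of_real ((L2_norm M f)\<^sup>2 + (L2_norm M g)\<^sup>2)"
    using assms fg by (simp add: L2_norm_squared_eq_inner del: of_real_power)
  thus ?thesis by (simp only: of_real_eq_iff)
qed

lemma L2_norm_sum_orthonormal:
  assumes "L2_orthonormal_basis M I e" "finite J" "J \<subseteq> I"
  shows "(L2_norm M (\<lambda>x. \<Sum>j\<in>J. c j * e j x))\<^sup>2 = (\<Sum>j\<in>J. (cmod (c j))\<^sup>2)"
  using assms(2,3)
proof (induction J rule: finite_induct)
  case empty
  show ?case by (simp add: L2_norm_def)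
next
  case (insert i J)
  have e: "e j \<in> L2 M" if "j \<in> insert i J" for j
    using assms(1) insert that by (auto simp: L2_orthonormal_basis_def)
  have on: "L2_inner M (e i) (e j) = (if i = j then 1 else 0)" if "j \<in> insert i J" for j
    using assms(1) insert that by (auto simp: L2_orthonormal_basis_def)
  have "L2_inner M (e i) (\<lambda>x. \<Sum>j\<in>J. c j * e j x) = 0"
    using e on insert by (subst L2_inner_sum_right) (auto intro!: sum.neutral)
  hence "L2_inner M (\<lambda>x. c i * e i x) (\<lambda>x. \<Sum>j\<in>J. c j * e j x) = 0"
    by (simp add: L2_inner_def mult.assoc)
  moreover have "(L2_norm M (\<lambda>x. c i * e i x))\<^sup>2 = (cmod (c i))\<^sup>2"
  proof -
    have "complex_of_real ((L2_norm M (\<lambda>x. e i x))\<^sup>2) = 1"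
      using on[of i] by (simp add: L2_norm_squared_eq_inner del: of_real_power)
    hence "(L2_norm M (e i))\<^sup>2 = 1" by (simp only: of_real_eq_1_iff)
    thus ?thesis by (simp add: L2_norm_squared norm_mult power_mult_distrib)
  qed
  ultimately have "(L2_norm M (\<lambda>x. c i * e i x + (\<Sum>j\<in>J. c j * e j x)))\<^sup>2 =
     (cmod (c i))\<^sup>2 + (L2_norm M (\<lambda>x. \<Sum>j\<in>J. c j * e j x))\<^sup>2"
    using e by (subst L2_norm_add_orthogonal) (auto intro!: L2_sum L2_mult_left)
  thus ?case using insert by simp
qed

lemma L2_norm_cong_AE:
  assumes "L2_eq M f g" "f \<in> L2 M" "g \<in> L2 M" shows "L2_norm M f = L2_norm M g"
proof -
  have [measurable]: "f \<in> borel_measurable M" "g \<in> borel_measurable M"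
    using assms by (auto simp: L2_def)
  have "(LINT x|M. (cmod (f x))\<^sup>2) = (LINT x|M. (cmod (g x))\<^sup>2)"
    using assms(1) by (intro integral_cong_AE) (auto simp: L2_eq_def)
  thus ?thesis by (simp add: L2_norm_def)
qed

lemma L2_indicator:
  assumes "S \<in> sets M" "emeasure M S < \<infinity>" shows "indicator S \<in> L2 M"
proof -
  have "(\<lambda>x. (cmod (indicator S x))\<^sup>2) = (indicator S :: _ \<Rightarrow> real)"
    by (simp add: indicator_def fun_eq_iff)
  moreover have "integrable M (indicator S :: _ \<Rightarrow> real)"
    using assms by (simp add: integrable_indicator_iff top.not_eq_extremum)
  ultimately show ?thesis using assms by (simp add: L2_def)
qed

lemma L2_bounded_operatorD:
  assumes "L2_bounded_operator M T" "f \<in> L2 M"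
  shows "T f \<in> L2 M"
    and "g \<in> L2 M \<Longrightarrow> L2_eq M (T (\<lambda>x. f x + g x)) (\<lambda>x. T f x + T g x)"
    and "L2_eq M (T (\<lambda>x. c * f x)) (\<lambda>x. c * T f x)"
  using assms by (simp_all add: L2_bounded_operator_def)

lemma L2_bounded_operator_bound:
  assumes "L2_bounded_operator M T"
  obtains C where "\<And>f. f \<in> L2 M \<Longrightarrow> L2_norm M (T f) \<le> C * L2_norm M f"
proof -
  from assms have "\<exists>C. \<forall>f\<in>L2 M. L2_norm M (T f) \<le> C * L2_norm M f"
    by (simp add: L2_bounded_operator_def)
  thus ?thesis using that by auto
qed

lemma L2_bounded_operator_sum:
  assumes T: "L2_bounded_operator M T" and "finite J" "\<And>j. j \<in> J \<Longrightarrow> f j \<in> L2 M"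
  shows "L2_eq M (T (\<lambda>x. \<Sum>j\<in>J. c j * f j x)) (\<lambda>x. \<Sum>j\<in>J. c j * T (f j) x)"
  using assms(2,3)
proof (induction J rule: finite_induct)
  case empty
  have "(\<lambda>x. 0) \<in> L2 M" by (simp add: L2_def)
  from L2_bounded_operatorD(3)[OF T this, of 0] show ?case by simp
next
  case (insert i J)
  have 1: "f i \<in> L2 M" "(\<lambda>x. c i * f i x) \<in> L2 M" "(\<lambda>x. \<Sum>j\<in>J. c j * f j x) \<in> L2 M"
    using insert by (auto intro!: L2_sum L2_mult_left)
  have "L2_eq M (T (\<lambda>x. c i * f i x + (\<Sum>j\<in>J. c j * f j x)))
      (\<lambda>x. T (\<lambda>x. c i * f i x) x + T (\<lambda>x. \<Sum>j\<in>J. c j * f j x) x)"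
    by (rule L2_bounded_operatorD(2)[OF T 1(2,3)])
  moreover have "L2_eq M (T (\<lambda>x. c i * f i x)) (\<lambda>x. c i * T (f i) x)"
    by (rule L2_bounded_operatorD(3)[OF T 1(1)])
  moreover have "L2_eq M (T (\<lambda>x. \<Sum>j\<in>J. c j * f j x)) (\<lambda>x. \<Sum>j\<in>J. c j * T (f j) x)"
    using insert by auto
  ultimately have "L2_eq M (T (\<lambda>x. c i * f i x + (\<Sum>j\<in>J. c j * f j x)))
     (\<lambda>x. c i * T (f i) x + (\<Sum>j\<in>J. c j * T (f j) x))"
    unfolding L2_eq_def by eventually_elim simp
  thus ?case using insert by simp
qed

lemma L2_eq_sum:
  assumes "finite J" "\<And>j. j \<in> J \<Longrightarrow> L2_eq M (f j) (g j)"
  shows "L2_eq M (\<lambda>x. \<Sum>j\<in>J. c j * f j x) (\<lambda>x. \<Sum>j\<in>J. c j * g j x)"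
proof -
  have "AE x in M. \<forall>j\<in>J. f j x = g j x"
    using assms by (simp add: AE_finite_all L2_eq_def)
  thus ?thesis unfolding L2_eq_def by eventually_elim simp
qed

lemma L2_Riesz_basis_synthesis:
  assumes T: "L2_bounded_operator M T" and "\<And>i. i \<in> I \<Longrightarrow> e i \<in> L2 M"
    and "\<And>i. i \<in> I \<Longrightarrow> L2_eq M (f i) (T (e i))" and "finite J" "J \<subseteq> I"
  shows "L2_eq M (\<lambda>x. \<Sum>j\<in>J. c j * f j x) (T (\<lambda>x. \<Sum>j\<in>J. c j * e j x))"
proof -
  have "L2_eq M (T (\<lambda>x. \<Sum>j\<in>J. c j * e j x)) (\<lambda>x. \<Sum>j\<in>J. c j * T (e j) x)"
    using assms by (intro L2_bounded_operator_sum[OF T]) auto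
  moreover have "L2_eq M (\<lambda>x. \<Sum>j\<in>J. c j * f j x) (\<lambda>x. \<Sum>j\<in>J. c j * T (e j) x)"
    using assms by (intro L2_eq_sum) auto
  ultimately show ?thesis unfolding L2_eq_def by eventually_elim simp
qed

text \<open>
  If \<open>f\<^sub>i = T e\<^sub>i\<close>, then the inverse of \<open>T\<close> carries \<open>\<Sum> c\<^sub>j f\<^sub>j\<close> back to \<open>\<Sum> c\<^sub>j e\<^sub>j\<close>, whose squared
  norm is \<open>\<Sum> |c\<^sub>j|\<^sup>2\<close>. The constant is the square of a bound for that inverse; adding 1 makes it
  positive.
\<close>

lemma L2_Riesz_basis_lower_bound:
  assumes "L2_Riesz_basis M (I :: 'i set) f"
  shows "\<exists>K>0. \<forall>J. \<forall>c :: 'i \<Rightarrow> complex. finite J \<longrightarrow> J \<subseteq> I \<longrightarrow>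
    (\<Sum>j\<in>J. (cmod (c j))\<^sup>2) \<le> K * (L2_norm M (\<lambda>x. \<Sum>j\<in>J. c j * f j x))\<^sup>2"
proof -
  obtain T e where inv: "L2_bounded_invertible M T" and e: "L2_orthonormal_basis M I e"
    and f': "\<forall>i\<in>I. L2_eq M (f i) (T (e i))" "\<forall>i\<in>I. f i \<in> L2 M"
    using assms(1) unfolding L2_Riesz_basis_def by blast
  obtain S where T: "L2_bounded_operator M T" and S1: "L2_bounded_operator M S"
    and S': "\<forall>h\<in>L2 M. L2_eq M (S (T h)) h \<and> L2_eq M (T (S h)) h"
    using inv unfolding L2_bounded_invertible_def by blast
  note f = f'(1)[rule_format] f'(2)[rule_format]
  have S2: "L2_eq M (S (T g)) g" if "g \<in> L2 M" for g
    using S' that by blast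
  note S = S1 S2
  have e2: "\<And>i. i \<in> I \<Longrightarrow> e i \<in> L2 M" using e by (auto simp: L2_orthonormal_basis_def)
  obtain C where C: "\<And>g. g \<in> L2 M \<Longrightarrow> L2_norm M (S g) \<le> C * L2_norm M g"
    using L2_bounded_operator_bound[OF S1] by blast
  have "(\<Sum>j\<in>J. (cmod (c j))\<^sup>2) \<le> (C\<^sup>2 + 1) * (L2_norm M (\<lambda>x. \<Sum>j\<in>J. c j * f j x))\<^sup>2"
    if J: "finite J" "J \<subseteq> I" for J c
  proof -
    define g where "g = (\<lambda>x. \<Sum>j\<in>J. c j * e j x)"
    define F where "F = (\<lambda>x. \<Sum>j\<in>J. c j * f j x)"
    have g: "g \<in> L2 M" unfolding g_def using J e2 by (intro L2_sum) auto
    have F: "F \<in> L2 M" unfolding F_def using J f by (intro L2_sum) auto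
    have Tg: "T g \<in> L2 M" by (rule L2_bounded_operatorD(1)[OF T g])
    have STg: "S (T g) \<in> L2 M" by (rule L2_bounded_operatorD(1)[OF S1 Tg])
    have "(\<Sum>j\<in>J. (cmod (c j))\<^sup>2) = (L2_norm M g)\<^sup>2"
      unfolding g_def using L2_norm_sum_orthonormal[OF e J] by simp
    also have "L2_norm M g = L2_norm M (S (T g))"
      using L2_norm_cong_AE[OF S(2)[OF g] STg g] by simp
    also have "\<dots>\<^sup>2 \<le> (C * L2_norm M (T g))\<^sup>2"
      by (intro power_mono C Tg L2_norm_nonneg)
    also have "L2_norm M (T g) = L2_norm M F"
      using L2_norm_cong_AE[OF L2_Riesz_basis_synthesis[OF T e2 f(1) J, where c=c]] F Tg
      by (simp add: F_def g_def)
    also have "(C * L2_norm M F)\<^sup>2 \<le> (C\<^sup>2 + 1) * (L2_norm M F)\<^sup>2"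
      by (simp add: power_mult_distrib algebra_simps)
    finally show ?thesis unfolding F_def .
  qed
  thus ?thesis by (intro exI[of _ "C\<^sup>2 + 1"]) (auto intro: add_nonneg_pos)
qed

text \<open>
  Finite combinations of the \<open>f\<^sub>i\<close> are dense, being the image under \<open>T\<close> of the finite combinations
  of an orthonormal basis. By Pythagoras, a vector orthogonal to all of them has distance at least
  its own norm from each.
\<close>

lemma L2_Riesz_basis_complete:
  assumes "L2_Riesz_basis M I f" and g: "g \<in> L2 M" and orth: "\<And>i. i \<in> I \<Longrightarrow> L2_inner M g (f i) = 0"
  shows "L2_norm M g = 0"
proof (rule ccontr)
  assume nz: "L2_norm M g \<noteq> 0"
  hence pos: "L2_norm M g > 0" using L2_norm_nonneg[of M g] by simp
  obtain T e where inv: "L2_bounded_invertible M T" and e: "L2_orthonormal_basis M I e"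
    and f': "\<forall>i\<in>I. L2_eq M (f i) (T (e i))" "\<forall>i\<in>I. f i \<in> L2 M"
    using assms(1) unfolding L2_Riesz_basis_def by blast
  obtain S where T: "L2_bounded_operator M T" and S1: "L2_bounded_operator M S"
    and S': "\<forall>h\<in>L2 M. L2_eq M (S (T h)) h \<and> L2_eq M (T (S h)) h"
    using inv unfolding L2_bounded_invertible_def by blast
  note f = f'(1)[rule_format] f'(2)[rule_format]
  have S2: "L2_eq M (T (S h)) h" if "h \<in> L2 M" for h
    using S' that by blast
  note S = S1 S2
  have e2: "\<And>i. i \<in> I \<Longrightarrow> e i \<in> L2 M" using e by (auto simp: L2_orthonormal_basis_def)
  obtain C where C: "\<And>g. g \<in> L2 M \<Longrightarrow> L2_norm M (T g) \<le> C * L2_norm M g"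
    using L2_bounded_operator_bound[OF T] by blast
  have Sg: "S g \<in> L2 M" by (rule L2_bounded_operatorD(1)[OF S1 g])
  have "L2_norm M g / (\<bar>C\<bar> + 1) > 0" using pos by (intro divide_pos_pos) auto
  with e Sg obtain J c where J: "finite J" "J \<subseteq> I"
    and Jc: "L2_norm M (\<lambda>x. S g x - (\<Sum>j\<in>J. c j * e j x)) < L2_norm M g / (\<bar>C\<bar> + 1)"
    unfolding L2_orthonormal_basis_def by blast
  \<comment> \<open>The signs turn the difference from the approximating combination into a sum.\<close>
  define s where "s = (\<lambda>x. \<Sum>j\<in>J. - c j * e j x)"
  define F where "F = (\<lambda>x. \<Sum>j\<in>J. - c j * f j x)"
  have s: "s \<in> L2 M" unfolding s_def using J e2 by (intro L2_sum) auto
  have F: "F \<in> L2 M" unfolding F_def using J f by (intro L2_sum) auto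
  have h: "(\<lambda>x. S g x + s x) \<in> L2 M" "T (\<lambda>x. S g x + s x) \<in> L2 M"
    using L2_add[OF Sg s] L2_bounded_operatorD(1)[OF T L2_add[OF Sg s]] by simp_all
  have "L2_eq M (T (\<lambda>x. S g x + s x)) (\<lambda>x. T (S g) x + T s x)"
    by (rule L2_bounded_operatorD(2)[OF T Sg s])
  moreover have "L2_eq M (T (S g)) g" by (rule S(2)[OF g])
  moreover have "L2_eq M F (T s)"
    unfolding F_def s_def by (rule L2_Riesz_basis_synthesis[OF T e2 f(1) J])
  ultimately have "L2_eq M (\<lambda>x. g x + F x) (T (\<lambda>x. S g x + s x))"
    unfolding L2_eq_def by eventually_elim simp
  hence "L2_norm M (\<lambda>x. g x + F x) = L2_norm M (T (\<lambda>x. S g x + s x))"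
    using L2_norm_cong_AE[OF _ L2_add[OF g F] h(2)] by simp
  also have "\<dots> \<le> C * L2_norm M (\<lambda>x. S g x + s x)" by (rule C[OF h(1)])
  also have "\<dots> \<le> (\<bar>C\<bar> + 1) * L2_norm M (\<lambda>x. S g x + s x)"
    by (intro mult_right_mono L2_norm_nonneg) auto
  also have "\<dots> < (\<bar>C\<bar> + 1) * (L2_norm M g / (\<bar>C\<bar> + 1))"
    using Jc by (intro mult_strict_left_mono) (auto simp: s_def sum_negf)
  also have "\<dots> = L2_norm M g" by (simp add: add_nonneg_eq_0_iff)
  finally have lt: "L2_norm M (\<lambda>x. g x + F x) < L2_norm M g" .
  have "L2_inner M g F = 0"
    unfolding F_def using J f orth by (subst L2_inner_sum_right[OF g]) (auto intro!: sum.neutral)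
  hence "(L2_norm M (\<lambda>x. g x + F x))\<^sup>2 \<ge> (L2_norm M g)\<^sup>2"
    using L2_norm_add_orthogonal[OF g F] by simp
  with lt show False using power2_le_imp_le[of "L2_norm M g"] L2_norm_nonneg
    by (meson not_le)
qed

section \<open>Completeness and residues of the p-adic numbers\<close>

lift_definition padic_of_rat :: "rat \<Rightarrow> 'p::prime_card padic" is "\<lambda>q n. q"
  by (simp add: padicrel_def)

lemma padic_of_rat_add: "padic_of_rat (x + y) = (padic_of_rat x + padic_of_rat y :: 'p::prime_card padic)"
  by transfer (simp add: padicrel_def)

lemma padic_of_rat_diff: "padic_of_rat (x - y) = (padic_of_rat x - padic_of_rat y :: 'p::prime_card padic)"
  by transfer (simp add: padicrel_def)

lemma padic_of_rat_0: "padic_of_rat 0 = (0 :: 'p::prime_card padic)"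
  by transfer (simp add: padicrel_def)

lemma padic_of_rat_1: "padic_of_rat 1 = (1 :: 'p::prime_card padic)"
  by transfer (simp add: padicrel_def)

lemma padic_of_rat_of_nat: "padic_of_rat (of_nat n) = (of_nat n :: 'p::prime_card padic)"
  by (induction n) (simp_all add: padic_of_rat_0 padic_of_rat_1 padic_of_rat_add)

lemma padic_norm_of_rat: "padic_norm (padic_of_rat q :: 'p::prime_card padic) = pabs CARD('p) q"
  by transfer simp

text \<open>
  Density of the rationals: a late term of a Cauchy sequence is close to its limit.
\<close>

lemma padic_of_rat_approx:
  fixes x :: "'p::prime_card padic"
  assumes "e > 0"
  shows "\<exists>q. padic_norm (x - padic_of_rat q) < e"
proof -
  have "\<exists>q. padic_norm (x - padic_of_rat q) \<le> e / 2"
  proof (transfer fixing: e)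
    note p = prime_card[where 'a='p]
    fix X assume X: "padicrel TYPE('p) X X"
    hence C: "pcauchy CARD('p) X" by (simp add: padicrel_def)
    obtain N where N: "\<forall>m\<ge>N. \<forall>n\<ge>N. pabs CARD('p) (X m - X n) < e / 2"
      using pcauchyD[OF C, of "e / 2"] assms by auto
    have "(\<lambda>n. pabs CARD('p) (X n - X N)) \<longlonglongrightarrow> lim (\<lambda>n. pabs CARD('p) (X n - X N))"
      by (intro pcauchy_lim[OF p] pcauchy_diff[OF p] C pcauchy_const)
    moreover have "\<forall>n\<ge>N. pabs CARD('p) (X n - X N) \<le> e / 2" using N by (auto intro: less_imp_le)
    ultimately show "\<exists>q. lim (\<lambda>n. pabs CARD('p) (X n - q)) \<le> e / 2"
      using LIMSEQ_le_const2 by blast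
  qed
  then obtain q where "padic_norm (x - padic_of_rat q) \<le> e / 2" by blast
  also have "e / 2 < e" using assms by simp
  finally show ?thesis by blast
qed

text \<open>
  The limit is the p-adic number that the sequence itself represents.
\<close>

lemma pcauchy_converges_padic:
  assumes X: "pcauchy CARD('p::prime_card) X"
  shows "\<exists>y :: 'p padic. (\<lambda>n. padic_of_rat (X n)) \<longlonglongrightarrow> y"
proof -
  have "\<exists>y :: 'p padic. \<forall>e>0. \<exists>N. \<forall>n\<ge>N. padic_norm (padic_of_rat (X n) - y) \<le> e"
  proof (transfer fixing: X)
    note p = prime_card[where 'a='p]
    have "\<exists>N. \<forall>n\<ge>N. lim (\<lambda>k. pabs CARD('p) (X n - X k)) \<le> e" if e: "e > 0" for e
    proof -
      obtain N where N: "\<forall>m\<ge>N. \<forall>n\<ge>N. pabs CARD('p) (X m - X n) < e"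
        using pcauchyD[OF X e] by blast
      have "lim (\<lambda>k. pabs CARD('p) (X n - X k)) \<le> e" if "n \<ge> N" for n
      proof (rule LIMSEQ_le_const2)
        show "(\<lambda>k. pabs CARD('p) (X n - X k)) \<longlonglongrightarrow> lim (\<lambda>k. pabs CARD('p) (X n - X k))"
          by (intro pcauchy_lim[OF p] pcauchy_diff[OF p] X pcauchy_const)
        show "\<exists>M. \<forall>k\<ge>M. pabs CARD('p) (X n - X k) \<le> e" using N that by (auto intro: less_imp_le)
      qed
      thus ?thesis by blast
    qed
    moreover have "padicrel TYPE('p) X X" using X by (simp add: padicrel_def)
    ultimately show "\<exists>Y\<in>{Y. padicrel TYPE('p) Y Y}. \<forall>e>0. \<exists>N. \<forall>n\<ge>N. lim (\<lambda>k. pabs CARD('p) (X n - Y k)) \<le> e"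
      by auto
  qed
  then obtain y :: "'p padic" where y: "\<And>e. e > 0 \<Longrightarrow> \<exists>N. \<forall>n\<ge>N. padic_norm (padic_of_rat (X n) - y) \<le> e"
    by blast
  have "\<exists>N. \<forall>n\<ge>N. dist (padic_of_rat (X n)) y < e" if e: "e > 0" for e
  proof -
    obtain N where "\<forall>n\<ge>N. padic_norm (padic_of_rat (X n) - y) \<le> e / 2"
      using y[OF half_gt_zero[OF e]] by blast
    thus ?thesis using e by (intro exI[of _ N]) (auto simp: dist_padic_def intro: le_less_trans)
  qed
  thus ?thesis by (auto simp: LIMSEQ_def)
qed

text \<open>
  A Cauchy sequence of p-adic numbers is shadowed by a sequence of rationals at distance below
  \<open>1 / (n + 1)\<close>, which is again Cauchy and whose limit serves for both.
\<close>

instance padic :: (prime_card) complete_space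
proof
  fix X :: "nat \<Rightarrow> 'a padic" assume X: "Cauchy X"
  have "\<forall>n. \<exists>q. padic_norm (X n - padic_of_rat q) < 1 / real (Suc n)"
    by (intro allI padic_of_rat_approx) simp
  then obtain q where "\<forall>n. padic_norm (X n - padic_of_rat (q n)) < 1 / real (Suc n)"
    by metis
  hence q: "dist (X n) (padic_of_rat (q n)) < 1 / real (Suc n)" for n by (simp add: dist_padic_def)
  have null: "(\<lambda>n. dist (padic_of_rat (q n)) (X n)) \<longlonglongrightarrow> 0"
  proof (rule Lim_null_comparison)
    show "(\<lambda>n. 1 / real (Suc n)) \<longlonglongrightarrow> 0" using LIMSEQ_inverse_real_of_nat by (simp add: inverse_eq_divide)
    show "\<forall>\<^sub>F n in sequentially. norm (dist (padic_of_rat (q n)) (X n)) \<le> 1 / real (Suc n)"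
      using q by (auto simp: dist_commute intro!: always_eventually less_imp_le)
  qed
  have "pcauchy CARD('a) q"
    unfolding pcauchy_def
  proof (intro allI impI)
    fix e :: real assume e: "e > 0"
    obtain N where N: "\<And>m n. m \<ge> N \<Longrightarrow> n \<ge> N \<Longrightarrow> dist (X m) (X n) < e / 3"
      using metric_CauchyD[OF X, of "e / 3"] e by auto
    obtain M where M: "\<And>n. n \<ge> M \<Longrightarrow> dist (padic_of_rat (q n)) (X n) < e / 3"
      using order_tendstoD(2)[OF null, of "e / 3"] e by (auto simp: eventually_sequentially)
    have "pabs CARD('a) (q m - q n) < e" if "m \<ge> max N M" "n \<ge> max N M" for m n
    proof -
      have "pabs CARD('a) (q m - q n) = dist (padic_of_rat (q m) :: 'a padic) (padic_of_rat (q n))"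
        by (simp add: dist_padic_def padic_norm_of_rat flip: padic_of_rat_diff)
      also have "\<dots> \<le> dist (padic_of_rat (q m)) (X m) + dist (X m) (X n) + dist (padic_of_rat (q n)) (X n)"
        using dist_triangle[of "padic_of_rat (q m) :: 'a padic" "padic_of_rat (q n)" "X n"]
          dist_triangle[of "padic_of_rat (q m) :: 'a padic" "X n" "X m"]
          dist_commute[of "padic_of_rat (q n) :: 'a padic" "X n"] by linarith
      also have "\<dots> < e" using N[of m n] M[of m] M[of n] that by simp
      finally show ?thesis .
    qed
    thus "\<exists>N. \<forall>m\<ge>N. \<forall>n\<ge>N. pabs CARD('a) (q m - q n) < e" by blast
  qed
  then obtain y :: "'a padic" where "(\<lambda>n. padic_of_rat (q n)) \<longlonglongrightarrow> y"
    using pcauchy_converges_padic by blast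
  hence y: "(\<lambda>n. dist (padic_of_rat (q n)) y) \<longlonglongrightarrow> 0" by (rule tendsto_dist_iff[THEN iffD1])
  have "(\<lambda>n. dist (X n) y) \<longlonglongrightarrow> 0"
  proof (rule Lim_null_comparison)
    show "(\<lambda>n. dist (padic_of_rat (q n)) (X n) + dist (padic_of_rat (q n)) y) \<longlonglongrightarrow> 0"
      by (rule tendsto_add_zero[OF null y])
    have "norm (dist (X n) y) \<le> dist (padic_of_rat (q n)) (X n) + dist (padic_of_rat (q n)) y" for n
      using dist_triangle3[of "X n" y "padic_of_rat (q n)"] by simp
    thus "\<forall>\<^sub>F n in sequentially. norm (dist (X n) y)
        \<le> dist (padic_of_rat (q n)) (X n) + dist (padic_of_rat (q n)) y"
      by (rule always_eventually[OF allI])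
  qed
  hence "X \<longlonglongrightarrow> y" by (rule tendsto_dist_iff[THEN iffD2])
  thus "convergent X" by (auto simp: convergent_def)
qed

lemma power_int_le_iff: "a powi m \<le> a powi n \<longleftrightarrow> m \<le> n" if a: "1 < a" for a :: "'a::linordered_field"
proof
  assume le: "a powi m \<le> a powi n"
  show "m \<le> n"
  proof (rule ccontr)
    assume "\<not> m \<le> n"
    hence "a powi n < a powi m" using a by (intro power_int_strict_increasing) auto
    with le show False by simp
  qed
qed (use a in \<open>auto intro: power_int_increasing\<close>)

lemma pabs_of_int_le_iff:
  assumes p: "prime p"
  shows "pabs p (of_int a) \<le> real p powi (- int e) \<longleftrightarrow> int p ^ e dvd a"
proof (cases "a = 0")
  case False
  have p1: "real p > 1" using p prime_gt_1_nat by simp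
  have "pabs p (of_int a) = real p powi (- int (multiplicity (int p) a))"
    using pabs_of_int_divide[OF p False, of 1] by simp
  hence "pabs p (of_int a) \<le> real p powi (- int e) \<longleftrightarrow> e \<le> multiplicity (int p) a"
    using p1 by (simp add: power_int_le_iff)
  also have "\<dots> \<longleftrightarrow> int p ^ e dvd a"
    using p False by (subst power_dvd_iff_le_multiplicity) (auto simp: prime_int_nat_transfer)
  finally show ?thesis .
qed simp

text \<open>
  A rational of absolute value at most 1 has, in lowest terms, a denominator prime to \<open>p\<close>. That
  denominator is invertible modulo \<open>p\<^sup>e\<close>, and the residue is the numerator times its inverse.
\<close>

lemma pabs_le_1_imp_residue:
  assumes p: "prime p" and q: "pabs p q \<le> 1"
  shows "\<exists>i<p ^ e. pabs p (q - of_nat i) \<le> real p powi (- int e)"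
proof -
  obtain a b where ab: "quotient_of q = (a, b)" by (cases "quotient_of q")
  have b: "b > 0" using quotient_of_denom_pos[OF ab] .
  have q_eq: "q = of_int a / of_int b" using quotient_of_div[OF ab] .
  have cop: "coprime a b" using quotient_of_coprime[OF ab] .
  have pos: "p ^ e > 0" using p by (simp add: prime_gt_0_nat)
  have ndvd: "\<not> int p dvd b"
  proof
    assume dvd: "int p dvd b"
    have pa: "\<not> int p dvd a"
    proof
      assume "int p dvd a"
      from coprime_common_divisor[OF cop this dvd] show False using p by simp
    qed
    hence "a \<noteq> 0" by auto
    have "multiplicity (int p) b \<ge> 1" using dvd b p
      by (intro multiplicity_geI) (auto simp: prime_gt_Suc_0_nat prime_nat_iff)
    moreover have "multiplicity (int p) a = 0" using pa by (rule not_dvd_imp_multiplicity_0)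
    ultimately have "pabs p q = real p ^ multiplicity (int p) b" "multiplicity (int p) b > 0"
      using pabs_of_int_divide[OF p \<open>a \<noteq> 0\<close>, of b] b q_eq by auto
    moreover have "real p > 1" using p prime_gt_1_nat by simp
    ultimately show False using q one_less_power[of "real p" "multiplicity (int p) b"] by linarith
  qed
  have "coprime (int p) b" using p ndvd by (intro prime_imp_coprime) auto
  hence "coprime b (int p ^ e)" by (simp add: coprime_commute)
  then obtain c where c: "[b * c = 1] (mod int p ^ e)" using cong_solve_coprime_int by blast
  \<comment> \<open>Here \<open>c\<close> inverts the denominator modulo \<open>p\<^sup>e\<close>.\<close>
  define i where "i = nat (a * c mod int p ^ e)"
  have i: "int i = a * c mod int p ^ e" using pos by (simp add: i_def p prime_gt_0_nat)
  have "int i < int (p ^ e)" unfolding i using p by (simp add: prime_gt_0_nat)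
  hence lt: "i < p ^ e" by (simp only: of_nat_less_iff)
  have "[a - int i * b = a - (a * c) * b] (mod int p ^ e)"
    unfolding i by (intro cong_diff cong_mult) (auto simp: cong_def)
  also have "[a - (a * c) * b = a - a * 1] (mod int p ^ e)"
    using cong_diff[OF cong_refl[of a] cong_mult[OF cong_refl[of a] c]] by (simp add: mult_ac)
  finally have "int p ^ e dvd a - int i * b" by (simp add: cong_0_iff)
  hence "pabs p (of_int (a - int i * b)) \<le> real p powi (- int e)"
    by (simp only: pabs_of_int_le_iff[OF p])
  moreover have "pabs p (of_int b) = 1"
    using pabs_of_int_divide[OF p, of b 1] b ndvd by (simp add: not_dvd_imp_multiplicity_0)
  moreover have "of_int (a - int i * b) = (q - of_nat i) * of_int b" using b by (simp add: q_eq field_simps)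
  ultimately have "pabs p (q - of_nat i) \<le> real p powi (- int e)" by (simp add: pabs_mult[OF p])
  with lt show ?thesis by blast
qed

lemma padic_norm_of_nat_diff:
  "padic_norm (of_nat i - of_nat j :: 'p::prime_card padic) = pabs CARD('p) (of_int (int i - int j))"
  by (simp add: padic_norm_of_rat flip: padic_of_rat_of_nat padic_of_rat_diff)

lemma padic_norm_card: "padic_norm (of_nat CARD('p) :: 'p::prime_card padic) = 1 / real CARD('p)"
proof -
  have p: "prime CARD('p)" by (rule prime_card)
  have "padic_norm (of_nat CARD('p) :: 'p padic) = pabs CARD('p) (of_int (int CARD('p)))"
    by (simp add: padic_norm_of_rat flip: padic_of_rat_of_nat)
  also have "\<dots> = real CARD('p) powi (- 1)"
    using pabs_of_int_divide[OF p, of "int CARD('p)" 1] p by (auto simp: not_prime_0)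
  finally show ?thesis by (simp add: power_int_minus inverse_eq_divide)
qed

lemma padic_norm_inverse: "padic_norm (inverse x) = inverse (padic_norm x)" for x :: "'p::prime_card padic"
proof (cases "x = 0")
  case False
  have "padic_norm (1 :: 'p padic) = 1"
    using padic_norm_of_rat[of 1, where 'p='p] by (simp add: padic_of_rat_1)
  hence "padic_norm x * padic_norm (inverse x) = 1"
    using False by (simp flip: padic_norm_mult)
  thus ?thesis by (simp add: inverse_unique)
qed simp

lemma padic_norm_power_int: "padic_norm (x powi k) = padic_norm x powi k" for x :: "'p::prime_card padic"
proof -
  have 1: "padic_norm (1 :: 'p padic) = 1"
    using padic_norm_of_rat[of 1, where 'p='p] by (simp add: padic_of_rat_1)
  have "padic_norm (x ^ n) = padic_norm x ^ n" for n
    by (induction n) (simp_all add: 1 padic_norm_mult)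
  thus ?thesis by (simp add: power_int_def padic_norm_inverse power_inverse)
qed

lemma padic_norm_uniformizer_power:
  "padic_norm (of_nat CARD('p) powi k :: 'p::prime_card padic) = real CARD('p) powi (- k)"
  by (simp add: padic_norm_power_int padic_norm_card power_int_divide_distrib power_int_minus inverse_eq_divide)

section \<open>Balls around the origin\<close>

definition padic_ball :: "int \<Rightarrow> 'p::prime_card padic set" where
  "padic_ball k = {x. padic_norm x \<le> real CARD('p) powi (- k)}"

lemma prime_card_gt_1: "real CARD('p::prime_card) > 1"
  using prime_gt_1_nat[OF prime_card, where 'a1='p] by simp

lemma padic_ball_0 [simp]: "0 \<in> padic_ball k"
  by (simp add: padic_ball_def)

lemma padic_ball_add: "x \<in> padic_ball k \<Longrightarrow> y \<in> padic_ball k \<Longrightarrow> x + y \<in> padic_ball k"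
  using padic_norm_ultra[of x y] by (auto simp: padic_ball_def)

lemma padic_ball_minus_iff [simp]: "- x \<in> padic_ball k \<longleftrightarrow> x \<in> padic_ball k"
  by (simp add: padic_ball_def)

lemma padic_ball_diff: "x \<in> padic_ball k \<Longrightarrow> y \<in> padic_ball k \<Longrightarrow> x - y \<in> padic_ball k"
  using padic_ball_add[of x k "- y"] by simp

lemma padic_ball_mono: "k \<le> l \<Longrightarrow> x \<in> padic_ball l \<Longrightarrow> x \<in> padic_ball k" for x :: "'p::prime_card padic"
  using power_int_increasing[of "- l" "- k" "real CARD('p)"] prime_card_gt_1[where 'p='p]
  by (auto simp: padic_ball_def)

lemma mem_coset_iff: "x \<in> (+) a ` H \<longleftrightarrow> x - a \<in> H" for a :: "'a::ab_group_add"
  by (force simp: image_iff)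

lemma padic_coset_eq_cball: "(+) a ` padic_ball k = cball a (real CARD('p) powi (- k))"
  for a :: "'p::prime_card padic"
proof -
  have "x \<in> (+) a ` padic_ball k \<longleftrightarrow> x \<in> cball a (real CARD('p) powi (- k))" for x
    unfolding mem_cball dist_commute[of a] mem_coset_iff by (simp add: padic_ball_def dist_padic_def)
  thus ?thesis by blast
qed

lemma padic_coset_closed: "closed ((+) a ` padic_ball k)" for a :: "'p::prime_card padic"
  unfolding padic_coset_eq_cball by simp

text \<open>
  By the ultrametric inequality, every point of a ball is a centre of it.
\<close>

lemma padic_coset_open: "open ((+) a ` padic_ball k)" for a :: "'p::prime_card padic"
  unfolding open_dist
proof
  fix x assume x: "x \<in> (+) a ` padic_ball k"
  have "y \<in> (+) a ` padic_ball k" if "dist y x < real CARD('p) powi (- k)" for y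
  proof -
    have "y - x \<in> padic_ball k" using that by (simp add: dist_padic_def padic_ball_def)
    moreover have "x - a \<in> padic_ball k" using x by (simp add: mem_coset_iff)
    ultimately have "(y - x) + (x - a) \<in> padic_ball k" by (rule padic_ball_add)
    thus ?thesis by (simp add: mem_coset_iff)
  qed
  moreover have "real CARD('p) powi (- k) > 0" using prime_card_gt_1[where 'p='p] by simp
  ultimately show "\<exists>e>0. \<forall>y. dist y x < e \<longrightarrow> y \<in> (+) a ` padic_ball k" by blast
qed

lemma padic_ball_open: "open (padic_ball k)" and padic_ball_closed: "closed (padic_ball k)"
  using padic_coset_open[of 0 k] padic_coset_closed[of 0 k] by simp_all

lemma padic_ball_mult_power_int:
  "of_nat CARD('p) powi j * z \<in> padic_ball (j + k) \<longleftrightarrow> z \<in> padic_ball k" for z :: "'p::prime_card padic"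
proof -
  have "real CARD('p) powi (- (j + k)) = real CARD('p) powi (- j) * real CARD('p) powi (- k)"
    using prime_card_gt_1[where 'p='p] by (simp flip: power_int_add)
  thus ?thesis using prime_card_gt_1[where 'p='p]
    by (simp add: padic_ball_def padic_norm_mult padic_norm_uniformizer_power)
qed

lemma padic_integers_eq_ball: "padic_integers = padic_ball 0"
  by (simp add: padic_integers_def padic_ball_def)

lemma padic_ball_eq_image: "(padic_ball j :: 'p padic set) = (*) (of_nat CARD('p) powi j) ` padic_integers"
  for j :: int and dummy :: "'p::prime_card itself"
proof -
  have nz: "(of_nat CARD('p) powi j :: 'p padic) \<noteq> 0"
  proof
    assume "(of_nat CARD('p) powi j :: 'p padic) = 0"
    hence "real CARD('p) powi (- j) = 0"
      using padic_norm_uniformizer_power[of j, where 'p='p] by (simp only: padic_norm_0)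
    thus False using prime_card_gt_1[where 'p='p] by simp
  qed
  have "x \<in> (*) (of_nat CARD('p) powi j) ` padic_integers" if "x \<in> padic_ball j" for x :: "'p padic"
  proof -
    have x: "x = of_nat CARD('p) powi j * (x / of_nat CARD('p) powi j)" using nz by simp
    have "x / of_nat CARD('p) powi j \<in> padic_integers"
      using that x padic_ball_mult_power_int[of j "x / of_nat CARD('p) powi j" 0]
      by (simp add: padic_integers_eq_ball)
    with x show ?thesis by blast
  qed
  moreover have "x \<in> padic_ball j" if "x \<in> (*) (of_nat CARD('p) powi j) ` padic_integers" for x :: "'p padic"
    using that padic_ball_mult_power_int[where 'p='p, of j _ 0] by (auto simp: padic_integers_eq_ball)
  ultimately show ?thesis by blast
qed

text \<open>
  Approximate \<open>x\<close> by a rational, which then is a p-adic integer too, and reduce that rational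
  modulo \<open>p\<^sup>e\<close>.
\<close>

lemma padic_integer_residue:
  assumes "x \<in> (padic_integers :: 'p::prime_card padic set)"
  shows "\<exists>i<CARD('p) ^ e. x - of_nat i \<in> padic_ball (int e)"
proof -
  have "real CARD('p) powi (- int e) > 0" using prime_card_gt_1[where 'p='p] by simp
  then obtain q where q: "padic_norm (x - padic_of_rat q) < real CARD('p) powi (- int e)"
    using padic_of_rat_approx by blast
  have "real CARD('p) powi (- int e) \<le> real CARD('p) powi 0"
    using prime_card_gt_1[where 'p='p] by (intro power_int_increasing) auto
  with q have xq: "x - padic_of_rat q \<in> padic_ball (int e)" "x - padic_of_rat q \<in> padic_ball 0"
    by (simp_all add: padic_ball_def)
  have "x - (x - padic_of_rat q) \<in> padic_ball 0"
    by (rule padic_ball_diff[OF assms[unfolded padic_integers_eq_ball] xq(2)])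
  hence "pabs CARD('p) q \<le> 1" by (simp add: padic_ball_def padic_norm_of_rat)
  from pabs_le_1_imp_residue[OF prime_card this, of e] obtain i where i: "i < CARD('p) ^ e"
    "pabs CARD('p) (q - of_nat i) \<le> real CARD('p) powi (- int e)" by blast
  hence "padic_of_rat q - of_nat i \<in> (padic_ball (int e) :: 'p padic set)"
    by (simp add: padic_ball_def padic_norm_of_rat flip: padic_of_rat_of_nat padic_of_rat_diff)
  from padic_ball_add[OF xq(1) this] i(1) show ?thesis by auto
qed

lemma padic_of_nat_residue_unique:
  assumes "of_nat i - of_nat j \<in> (padic_ball (int e) :: 'p::prime_card padic set)"
    and "i < CARD('p) ^ e" "j < CARD('p) ^ e"
  shows "i = j"
proof -
  have "int CARD('p) ^ e dvd int i - int j"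
    using assms(1) pabs_of_int_le_iff[OF prime_card, of "int i - int j" e, where 'a1='p]
    by (simp add: padic_ball_def padic_norm_of_nat_diff del: of_int_diff)
  hence "int (i mod CARD('p) ^ e) = int (j mod CARD('p) ^ e)"
    by (simp add: mod_eq_dvd_iff zmod_int)
  thus ?thesis using assms by simp
qed

section \<open>Tilings by cosets of a ball, and compactness\<close>

definition padic_tiling :: "int \<Rightarrow> 'p::prime_card padic set \<Rightarrow> 'p padic set \<Rightarrow> bool" where
  "padic_tiling k A U \<longleftrightarrow> finite A \<and> (\<forall>a\<in>A. \<forall>b\<in>A. a - b \<in> padic_ball k \<longrightarrow> a = b) \<and>
     U = (\<Union>a\<in>A. (+) a ` padic_ball k)"

lemma padic_tiling_mem_iff: "padic_tiling k A U \<Longrightarrow> x \<in> U \<longleftrightarrow> (\<exists>a\<in>A. x - a \<in> padic_ball k)"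
  by (simp add: padic_tiling_def mem_coset_iff)

lemma padic_tiling_disjoint:
  assumes "padic_tiling k A U" shows "disjoint_family_on (\<lambda>a. (+) a ` padic_ball k) A"
  unfolding disjoint_family_on_def
proof (intro ballI impI)
  fix a b assume ab: "a \<in> A" "b \<in> A" "a \<noteq> b"
  have False if "x - a \<in> padic_ball k" "x - b \<in> padic_ball k" for x
    using padic_ball_diff[OF that(2,1)] assms ab by (auto simp: padic_tiling_def)
  thus "(+) a ` padic_ball k \<inter> (+) b ` padic_ball k = {}"
    unfolding disjoint_iff mem_coset_iff by blast
qed

lemma padic_tiling_coset: "padic_tiling k {a} ((+) a ` padic_ball k)"
  by (simp add: padic_tiling_def)

lemma padic_tiling_union:
  assumes "padic_tiling k A U" "padic_tiling k B V" "U \<inter> V = {}"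
  shows "padic_tiling k (A \<union> B) (U \<union> V)" "A \<inter> B = {}"
proof -
  note U = padic_tiling_mem_iff[OF assms(1)] and V = padic_tiling_mem_iff[OF assms(2)]
  have "a \<in> U" if "a \<in> A" for a unfolding U using that by (intro bexI[of _ a]) simp_all
  moreover have "b \<in> V" if "b \<in> B" for b unfolding V using that by (intro bexI[of _ b]) simp_all
  ultimately have mem: "A \<subseteq> U" "B \<subseteq> V" by blast+
  thus "A \<inter> B = {}" using assms(3) by blast
  have "a - b \<notin> padic_ball k" if "a \<in> A" "b \<in> B" for a b
  proof
    assume "a - b \<in> padic_ball k"
    hence "a \<in> V" using that unfolding V by blast
    with that mem assms(3) show False by blast
  qed
  moreover from this have "b - a \<notin> padic_ball k" if "a \<in> A" "b \<in> B" for a b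
    using that padic_ball_minus_iff[of "a - b" k] by simp
  ultimately show "padic_tiling k (A \<union> B) (U \<union> V)"
    using assms(1,2) by (auto simp: padic_tiling_def)
qed

text \<open>
  The tiles are the translates by \<open>p\<^sup>j i\<close> for \<open>i\<close> running through the residues modulo \<open>p\<^sup>k\<^sup>-\<^sup>j\<close>.
\<close>

lemma padic_tiling_ball:
  assumes "j \<le> k"
  shows "\<exists>B. padic_tiling k B (padic_ball j :: 'p::prime_card padic set) \<and> card B = CARD('p) ^ nat (k - j)"
proof -
  define e where "e = nat (k - j)"
  have k: "k = j + int e" using assms by (simp add: e_def)
  define \<pi> :: "'p padic" where "\<pi> = of_nat CARD('p) powi j"
  define B where "B = (\<lambda>i. \<pi> * of_nat i) ` {..<CARD('p) ^ e}"
  have uniq: "i = i'" if "\<pi> * of_nat i - \<pi> * of_nat i' \<in> padic_ball k" "i < CARD('p) ^ e" "i' < CARD('p) ^ e" for i i'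
    using that padic_ball_mult_power_int[where 'p='p, of j "of_nat i - of_nat i'" "int e"]
    by (intro padic_of_nat_residue_unique[where 'p='p, of i i' e]) (simp_all add: \<pi>_def k right_diff_distrib)
  have "inj_on (\<lambda>i. \<pi> * of_nat i) {..<CARD('p) ^ e}"
    by (intro inj_onI uniq) auto
  hence "card B = CARD('p) ^ e" by (simp add: B_def card_image)
  moreover have "padic_tiling k B (padic_ball j)"
    unfolding padic_tiling_def
  proof (intro conjI ballI impI equalityI subsetI)
    show "finite B" by (simp add: B_def)
    show "a = b" if "a \<in> B" "b \<in> B" "a - b \<in> padic_ball k" for a b
      using that uniq by (auto simp: B_def)
    show "x \<in> (\<Union>a\<in>B. (+) a ` padic_ball k)" if x: "x \<in> padic_ball j" for x
    proof -
      obtain z where z: "x = \<pi> * z" "z \<in> padic_integers"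
        using x unfolding padic_ball_eq_image[of j, where 'p='p] \<pi>_def by blast
      obtain i where i: "i < CARD('p) ^ e" "z - of_nat i \<in> padic_ball (int e)"
        using padic_integer_residue[OF z(2), of e] by blast
      have "x - \<pi> * of_nat i \<in> padic_ball k"
        using i(2) padic_ball_mult_power_int[where 'p='p, of j "z - of_nat i" "int e"]
        by (simp add: \<pi>_def k z right_diff_distrib)
      thus ?thesis using i(1) unfolding UN_iff mem_coset_iff by (auto simp: B_def)
    qed
    show "x \<in> padic_ball j" if x: "x \<in> (\<Union>a\<in>B. (+) a ` padic_ball k)" for x
    proof -
      obtain i where i: "x - \<pi> * of_nat i \<in> padic_ball k"
        using x unfolding UN_iff mem_coset_iff by (auto simp: B_def)
      have "of_nat i - of_nat 0 \<in> (padic_ball (int 0) :: 'p padic set)"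
        unfolding padic_ball_def mem_Collect_eq padic_norm_of_nat_diff pabs_of_int_le_iff[OF prime_card]
        by simp
      hence "\<pi> * of_nat i \<in> padic_ball j"
        using padic_ball_mult_power_int[where 'p='p, of j "of_nat i" 0] by (simp add: \<pi>_def)
      from padic_ball_add[OF this padic_ball_mono[OF assms i]] show ?thesis by simp
    qed
  qed
  ultimately show ?thesis unfolding e_def by blast
qed

text \<open>
  Each coset of the large ball is tiled like the large ball itself.
\<close>

lemma padic_tiling_refine:
  assumes A: "padic_tiling k A U" and "k \<le> l"
  shows "\<exists>B. padic_tiling l B (U :: 'p::prime_card padic set) \<and> card B = card A * CARD('p) ^ nat (l - k)"
proof -
  obtain R where R: "padic_tiling l R (padic_ball k :: 'p padic set)" "card R = CARD('p) ^ nat (l - k)"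
    using padic_tiling_ball[OF \<open>k \<le> l\<close>] by blast
  have RB: "r \<in> padic_ball k" if "r \<in> R" for r
    unfolding padic_tiling_mem_iff[OF R(1)] using that by (intro bexI[of _ r]) simp_all
  have fin: "finite A" "finite R" using A R by (auto simp: padic_tiling_def)
  have uniq: "a = a' \<and> r = r'" if "a \<in> A" "a' \<in> A" "r \<in> R" "r' \<in> R" "(a + r) - (a' + r') \<in> padic_ball l" for a a' r r'
  proof -
    have "((a + r) - (a' + r')) + (r' - r) \<in> padic_ball k"
      by (rule padic_ball_add[OF padic_ball_mono[OF \<open>k \<le> l\<close> that(5)] padic_ball_diff[OF RB[OF that(4)] RB[OF that(3)]]])
    moreover have "((a + r) - (a' + r')) + (r' - r) = a - a'" by simp
    ultimately have "a - a' \<in> padic_ball k" by (simp only:)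
    hence a: "a = a'" using A that by (simp add: padic_tiling_def)
    with that R have "r = r'" by (simp add: padic_tiling_def)
    with a show ?thesis ..
  qed
  define B where "B = (\<lambda>(a, r). a + r) ` (A \<times> R)"
  have "inj_on (\<lambda>(a, r). a + r) (A \<times> R)"
    using uniq by (auto intro!: inj_onI)
  hence "card B = card A * CARD('p) ^ nat (l - k)"
    by (simp add: B_def card_image card_cartesian_product R(2))
  moreover have "padic_tiling l B U"
    unfolding padic_tiling_def
  proof (intro conjI ballI impI)
    show "finite B" using fin by (simp add: B_def)
    show "a = b" if "a \<in> B" "b \<in> B" "a - b \<in> padic_ball l" for a b
      using that uniq by (fastforce simp: B_def)
    have U_iff: "x \<in> U \<longleftrightarrow> (\<exists>a\<in>A. \<exists>r\<in>R. x - (a + r) \<in> padic_ball l)" for x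
      unfolding padic_tiling_mem_iff[OF A] padic_tiling_mem_iff[OF R(1)] diff_diff_eq ..
    have B_iff: "x \<in> (\<Union>b\<in>B. (+) b ` padic_ball l) \<longleftrightarrow> (\<exists>a\<in>A. \<exists>r\<in>R. x - (a + r) \<in> padic_ball l)" for x
      unfolding UN_iff mem_coset_iff by (simp add: B_def)
    show "U = (\<Union>b\<in>B. (+) b ` padic_ball l)"
      by (rule Set.set_eqI) (simp only: U_iff B_iff)
  qed
  ultimately show ?thesis by blast
qed

text \<open>
  A closed ball is complete, and its tilings by ever smaller cosets show that it is totally
  bounded.
\<close>

lemma compact_padic_ball: "compact (padic_ball k :: 'p::prime_card padic set)"
  unfolding compact_eq_totally_bounded
proof (intro conjI allI impI)
  show "complete (padic_ball k :: 'p padic set)"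
    by (simp add: complete_eq_closed padic_ball_closed)
  fix e :: real assume "e > 0"
  have "inverse (real CARD('p)) < 1" using prime_card_gt_1[where 'p='p] by (simp add: inverse_less_1_iff)
  then obtain n where n: "inverse (real CARD('p)) ^ n < e"
    using real_arch_pow_inv[OF \<open>e > 0\<close>] by blast
  define l where "l = max k (int n)"
  have "real CARD('p) powi (- l) \<le> real CARD('p) powi (- int n)"
    using prime_card_gt_1[where 'p='p] by (intro power_int_increasing) (auto simp: l_def)
  also have "\<dots> < e" using n by (simp add: power_int_minus power_inverse)
  finally have le: "real CARD('p) powi (- l) < e" .
  obtain B where B: "padic_tiling l B (padic_ball k :: 'p padic set)"
    using padic_tiling_ball[of k l] by (auto simp: l_def)
  have "(padic_ball k :: 'p padic set) = (\<Union>b\<in>B. cball b (real CARD('p) powi (- l)))"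
    using B by (simp add: padic_tiling_def padic_coset_eq_cball)
  also have "\<dots> \<subseteq> (\<Union>b\<in>B. ball b e)" using le by (intro UN_mono) auto
  finally show "\<exists>K. finite K \<and> (padic_ball k :: 'p padic set) \<subseteq> (\<Union>x\<in>K. ball x e)"
    using B by (auto simp: padic_tiling_def)
qed

section \<open>Haar measure of cosets\<close>

lemma haar_sets: "haar_measure \<mu> \<Longrightarrow> sets \<mu> = sets borel"
  by (simp add: haar_measure_def)

lemma haar_measure_translate:
  "haar_measure \<mu> \<Longrightarrow> B \<in> sets borel \<Longrightarrow> emeasure \<mu> ((+) a ` B) = emeasure \<mu> B"
  and haar_measure_compact: "haar_measure \<mu> \<Longrightarrow> compact K \<Longrightarrow> emeasure \<mu> K < \<infinity>"
  and haar_measure_open: "haar_measure \<mu> \<Longrightarrow> open V \<Longrightarrow> V \<noteq> {} \<Longrightarrow> emeasure \<mu> V > 0"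
  by (simp_all add: haar_measure_def)

lemma haar_space: "haar_measure \<mu> \<Longrightarrow> space \<mu> = UNIV"
  using sets_eq_imp_space_eq[OF haar_sets] by simp

lemma padic_coset_borel: "(+) a ` padic_ball k \<in> sets borel" for a :: "'p::prime_card padic"
  using padic_coset_open by (rule borel_open)

lemma haar_coset_finite:
  fixes a :: "'p::prime_card padic"
  assumes "haar_measure \<mu>"
  shows "emeasure \<mu> ((+) a ` padic_ball k) < \<infinity>"
proof -
  have "padic_ball k \<in> sets (borel :: 'p padic measure)" using padic_ball_open by (rule borel_open)
  hence "emeasure \<mu> ((+) a ` padic_ball k) = emeasure \<mu> (padic_ball k)"
    by (rule haar_measure_translate[OF assms])
  also have "\<dots> < \<infinity>" by (rule haar_measure_compact[OF assms compact_padic_ball])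
  finally show ?thesis .
qed

lemma haar_coset_measure:
  fixes a :: "'p::prime_card padic"
  assumes "haar_measure \<mu>"
  shows "measure \<mu> ((+) a ` padic_ball k) = measure \<mu> (padic_ball k)"
proof -
  have "padic_ball k \<in> sets (borel :: 'p padic measure)" using padic_ball_open by (rule borel_open)
  thus ?thesis by (simp add: haar_measure_translate[OF assms] measure_def)
qed

lemma haar_ball_measure_pos:
  assumes "haar_measure \<mu>"
  shows "measure \<mu> (padic_ball k :: 'p::prime_card padic set) > 0"
proof -
  have "(padic_ball k :: 'p padic set) \<noteq> {}" using padic_ball_0 by blast
  hence "emeasure \<mu> (padic_ball k :: 'p padic set) > 0"
    by (rule haar_measure_open[OF assms padic_ball_open])
  moreover have "emeasure \<mu> (padic_ball k :: 'p padic set) < \<infinity>"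
    using haar_coset_finite[OF assms, of 0 k] by simp
  ultimately show ?thesis by (simp add: measure_def enn2real_positive_iff)
qed

lemma padic_tiling_borel: "padic_tiling k A U \<Longrightarrow> U \<in> sets borel"
  using padic_coset_borel by (auto simp: padic_tiling_def intro!: sets.finite_UN)

lemma haar_tiling_measure:
  assumes \<mu>: "haar_measure \<mu>" and A: "padic_tiling k A U"
  shows "measure \<mu> U = real (card A) * measure \<mu> (padic_ball k)"
proof -
  have U: "finite A" "U = (\<Union>a\<in>A. (+) a ` padic_ball k)" using A by (auto simp: padic_tiling_def)
  have "measure \<mu> U = (\<Sum>a\<in>A. measure \<mu> ((+) a ` padic_ball k))"
    unfolding U(2)
  proof (rule measure_finite_Union)
    show "(\<lambda>a. (+) a ` padic_ball k) ` A \<subseteq> sets \<mu>"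
      using padic_coset_borel haar_sets[OF \<mu>] by auto
    show "emeasure \<mu> ((+) a ` padic_ball k) \<noteq> \<infinity>" for a
      using haar_coset_finite[OF \<mu>, of a k] by simp
  qed (use U padic_tiling_disjoint[OF A] in auto)
  thus ?thesis by (simp add: haar_coset_measure[OF \<mu>])
qed

text \<open>
  The index of one ball in another is the size of the tiling.
\<close>

lemma haar_ball_measure_ratio:
  assumes "haar_measure (\<mu> :: 'p::prime_card padic measure)" "j \<le> k"
  shows "measure \<mu> (padic_ball j) = real CARD('p) ^ nat (k - j) * measure \<mu> (padic_ball k)"
  using padic_tiling_ball[OF assms(2), where 'p='p] haar_tiling_measure[OF assms(1)] by fastforce

lemma haar_integral_translate:
  fixes f :: "'p::prime_card padic \<Rightarrow> complex"
  assumes \<mu>: "haar_measure \<mu>" and f: "f \<in> borel_measurable borel"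
  shows "(LINT x|\<mu>. f (a + x)) = (LINT x|\<mu>. f x)"
proof -
  have "continuous_on UNIV ((+) a)"
    unfolding continuous_on_iff by (auto simp: dist_padic_def)
  hence meas: "(+) a \<in> measurable \<mu> borel"
    using measurable_cong_sets[OF haar_sets[OF \<mu>] refl] borel_measurable_continuous_onI by blast
  have "distr \<mu> borel ((+) a) = \<mu>"
  proof (rule measure_eqI)
    show "sets (distr \<mu> borel ((+) a)) = sets \<mu>" by (simp add: haar_sets[OF \<mu>])
    fix B assume "B \<in> sets (distr \<mu> borel ((+) a))"
    hence B: "B \<in> sets borel" by simp
    have "(+) a -` B = (+) (- a) ` B" 
      by (rule Set.set_eqI) (simp only: mem_coset_iff vimage_eq, simp add: add.commute)
    thus "emeasure (distr \<mu> borel ((+) a)) B = emeasure \<mu> B"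
      using haar_measure_translate[OF \<mu> B, of "- a"] B
      by (simp add: emeasure_distr[OF meas] haar_space[OF \<mu>])
  qed
  thus ?thesis using integral_distr[OF meas f] by simp
qed

section \<open>Characters\<close>

lemma continuous_character_add: "continuous_character \<psi> \<Longrightarrow> \<psi> (x + y) = \<psi> x * \<psi> y"
  and continuous_character_norm: "continuous_character \<psi> \<Longrightarrow> cmod (\<psi> x) = 1"
  by (simp_all add: continuous_character_def)

lemma continuous_character_0: "continuous_character \<psi> \<Longrightarrow> \<psi> 0 = 1"
  using continuous_character_add[of \<psi> 0 0] continuous_character_norm[of \<psi> 0] by auto

lemma continuous_character_of_nat:
  "continuous_character \<psi> \<Longrightarrow> \<psi> (x * of_nat i) = \<psi> x ^ i"
  by (induction i) (simp_all add: continuous_character_0 continuous_character_add distrib_left)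

lemma continuous_character_measurable:
  "continuous_character \<psi> \<Longrightarrow> \<psi> \<in> borel_measurable borel"
  by (intro borel_measurable_continuous_onI) (simp add: continuous_character_def)

lemma integral_indicator_complex:
  "(LINT x|M. (indicator S x :: complex)) = of_real (measure M (S \<inter> space M))"
proof -
  have "(\<lambda>x. indicator S x :: complex) = (\<lambda>x. of_real (indicator S x))"
    by (simp add: indicator_def fun_eq_iff)
  thus ?thesis by simp
qed

text \<open>
  Orthogonality of characters on a coset. If \<open>\<psi> h \<noteq> 1\<close> for some \<open>h\<close> in the ball, then translation
  by \<open>h\<close> preserves the coset and multiplies the integral by \<open>cnj (\<psi> h)\<close>, so the integral vanishes.
\<close>

lemma continuous_character_coset_integral:
  assumes \<mu>: "haar_measure \<mu>" and \<psi>: "continuous_character (\<psi> :: 'p::prime_card padic \<Rightarrow> complex)"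
  shows "(LINT x|\<mu>. indicator ((+) a ` padic_ball k) x * cnj (\<psi> x)) =
    (if \<forall>h\<in>padic_ball k. \<psi> h = 1 then of_real (measure \<mu> (padic_ball k)) * cnj (\<psi> a) else 0)"
proof (cases "\<forall>h\<in>padic_ball k. \<psi> h = 1")
  case True
  have eq: "\<psi> x = \<psi> a" if "x - a \<in> padic_ball k" for x
    using continuous_character_add[OF \<psi>, of "x - a" a] bspec[OF True that] by simp
  have "indicator ((+) a ` padic_ball k) x * cnj (\<psi> x) = indicator ((+) a ` padic_ball k) x * cnj (\<psi> a)" for x
    using eq[of x] by (cases "x - a \<in> padic_ball k") (simp_all add: indicator_def mem_coset_iff)
  hence "(LINT x|\<mu>. indicator ((+) a ` padic_ball k) x * cnj (\<psi> x)) =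
     (LINT x|\<mu>. indicator ((+) a ` padic_ball k) x * cnj (\<psi> a))"
    by (simp only:)
  also have "\<dots> = of_real (measure \<mu> ((+) a ` padic_ball k)) * cnj (\<psi> a)"
    by (simp add: haar_space[OF \<mu>] integral_indicator_complex)
  finally show ?thesis using True by (simp add: haar_coset_measure[OF \<mu>])
next
  case False
  then obtain h where h: "h \<in> padic_ball k" "\<psi> h \<noteq> 1" by blast
  define f where "f x = indicator ((+) a ` padic_ball k) x * cnj (\<psi> x)" for x
  have "h + x - a \<in> padic_ball k \<longleftrightarrow> x - a \<in> padic_ball k" for x
    using padic_ball_add[OF h(1), of "x - a"] padic_ball_diff[OF _ h(1), of "h + x - a"]
    by (metis add_diff_cancel_left' add_diff_eq diff_diff_eq2 diff_right_commute)
  hence "indicator ((+) a ` padic_ball k) (h + x) = (indicator ((+) a ` padic_ball k) x :: complex)" for x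
    unfolding indicator_def mem_coset_iff by (simp only:)
  hence eq: "f (h + x) = cnj (\<psi> h) * f x" for x
    by (simp only: f_def continuous_character_add[OF \<psi>] complex_cnj_mult mult_ac)
  have [measurable]: "(\<lambda>x. cnj (\<psi> x)) \<in> borel_measurable borel"
    using continuous_character_measurable[OF \<psi>]
    by (intro borel_measurable_continuous_on[of cnj] continuous_intros)
  have [measurable]: "(+) a ` padic_ball k \<in> sets borel" by (rule padic_coset_borel)
  have "f \<in> borel_measurable borel" unfolding f_def[abs_def] by measurable
  hence "integral\<^sup>L \<mu> f = (LINT x|\<mu>. f (h + x))" by (simp add: haar_integral_translate[OF \<mu>])
  also have "\<dots> = cnj (\<psi> h) * integral\<^sup>L \<mu> f" by (simp add: eq)
  finally have "integral\<^sup>L \<mu> f = 0" using h(2) by simp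
  thus ?thesis by (subst if_not_P[OF False]) (simp only: f_def[abs_def])
qed

section \<open>Counting characters in a Riesz basis\<close>

text \<open>
  Suppose that fewer than \<open>card A\<close> members of the basis are trivial on the ball. Orthogonality to
  these imposes fewer linear conditions than a step function on the tiles of \<open>V\<close> has coefficients,
  so some nonzero step function satisfies them. It is orthogonal to the other members of the basis
  as well, because a character that is nontrivial on the ball integrates to zero over each tile.
  This contradicts completeness.
\<close>

lemma Riesz_basis_trivial_characters:
  fixes \<mu> :: "'p::prime_card padic measure"
  assumes \<mu>: "haar_measure \<mu>" and \<Omega>: "\<Omega> \<in> sets borel"
    and X: "\<forall>\<psi>\<in>X. continuous_character \<psi>"
    and basis: "L2_Riesz_basis (restrict_space \<mu> \<Omega>) X (\<lambda>\<psi>. \<psi>)"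
    and A: "padic_tiling l A V" and V: "V \<subseteq> \<Omega>"
  shows "\<exists>D\<subseteq>X. finite D \<and> card D = card A \<and> (\<forall>\<psi>\<in>D. \<forall>h\<in>padic_ball l. \<psi> h = 1)"
proof -
  define M where "M = restrict_space \<mu> \<Omega>"
  define C where "C = {\<psi>\<in>X. \<forall>h\<in>padic_ball l. \<psi> h = 1}"
  have \<Omega>\<mu>: "\<Omega> \<inter> space \<mu> \<in> sets \<mu>" using \<Omega> by (simp add: haar_sets[OF \<mu>] haar_space[OF \<mu>])
  have finA: "finite A" using A by (simp add: padic_tiling_def)
  have sub: "(+) a ` padic_ball l \<subseteq> \<Omega>" if "a \<in> A" for a
    using A V that by (auto simp: padic_tiling_def)
  have tiles_M: "(+) a ` padic_ball l \<in> sets M" "emeasure M ((+) a ` padic_ball l) < \<infinity>" if "a \<in> A" for a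
  proof -
    show "(+) a ` padic_ball l \<in> sets M"
      using sub[OF that] padic_coset_borel[of a l] \<Omega>\<mu>
      by (simp add: M_def sets_restrict_space_iff haar_sets[OF \<mu>])
    show "emeasure M ((+) a ` padic_ball l) < \<infinity>"
      using haar_coset_finite[OF \<mu>, of a l] sub[OF that] \<Omega>\<mu> by (simp add: M_def emeasure_restrict_space)
  qed
  have X2: "\<psi> \<in> L2 M" if "\<psi> \<in> X" for \<psi>
    using basis that by (simp add: L2_Riesz_basis_def M_def)
  have card_le: "card A \<le> card C" if finC: "finite C"
  proof (rule ccontr)
    assume "\<not> card A \<le> card C"
    hence "card C < card A" by simp
    from homogeneous_system_nontrivial_solution[OF finC finA this, of "\<lambda>\<psi> a. cnj (\<psi> a)"]
    obtain v a0 where v: "\<forall>\<psi>\<in>C. (\<Sum>a\<in>A. v a * cnj (\<psi> a)) = 0" and a0: "a0 \<in> A" "v a0 \<noteq> 0" by blast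
    \<comment> \<open>The step function with coefficients \<open>v\<close>; it is nonzero on the tile of \<open>a0\<close>.\<close>
    define f where "f = (\<lambda>x. \<Sum>a\<in>A. v a * indicator ((+) a ` padic_ball l) x)"
    have f2: "f \<in> L2 M" unfolding f_def using tiles_M by (intro L2_sum L2_indicator)
    have "L2_inner M f \<psi> = 0" if \<psi>: "\<psi> \<in> X" for \<psi>
    proof -
      have ind: "L2_inner M (indicator ((+) a ` padic_ball l)) \<psi> =
        (if \<psi> \<in> C then of_real (measure \<mu> (padic_ball l)) * cnj (\<psi> a) else 0)" if a: "a \<in> A" for a
      proof -
        have "L2_inner M (indicator ((+) a ` padic_ball l)) \<psi> =
          (LINT x|\<mu>. indicator \<Omega> x *\<^sub>R (indicator ((+) a ` padic_ball l) x * cnj (\<psi> x)))"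
          unfolding L2_inner_def M_def by (rule integral_restrict_space[OF \<Omega>\<mu>])
        also have "\<dots> = (LINT x|\<mu>. indicator ((+) a ` padic_ball l) x * cnj (\<psi> x))"
          using sub[OF a] by (intro Bochner_Integration.integral_cong refl) (auto simp: indicator_def)
        also have "\<dots> = (if \<forall>h\<in>padic_ball l. \<psi> h = 1 then of_real (measure \<mu> (padic_ball l)) * cnj (\<psi> a) else 0)"
          using X \<psi> by (intro continuous_character_coset_integral[OF \<mu>]) blast
        finally show ?thesis using \<psi> by (simp add: C_def)
      qed
      have "L2_inner M \<psi> f = (\<Sum>a\<in>A. cnj (v a) * L2_inner M \<psi> (indicator ((+) a ` padic_ball l)))"
        unfolding f_def using tiles_M by (intro L2_inner_sum_right X2 \<psi> L2_indicator)
      hence "L2_inner M f \<psi> = (\<Sum>a\<in>A. v a * L2_inner M (indicator ((+) a ` padic_ball l)) \<psi>)"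
        using L2_inner_commute[of M f \<psi>] L2_inner_commute[of M "indicator _" \<psi>] by simp
      also have "\<dots> = (if \<psi> \<in> C then of_real (measure \<mu> (padic_ball l)) * (\<Sum>a\<in>A. v a * cnj (\<psi> a)) else 0)"
        using ind by (simp add: sum_distrib_left mult_ac)
      also have "\<dots> = 0" using v by simp
      finally show ?thesis .
    qed
    hence "L2_norm M f = 0"
      using L2_Riesz_basis_complete[OF basis[folded M_def] f2] by blast
    hence "(LINT x|M. (cmod (f x))\<^sup>2) = 0" using L2_norm_squared[of M f] by simp
    moreover have "(LINT x|M. indicator ((+) a0 ` padic_ball l) x * (cmod (v a0))\<^sup>2) \<le> (LINT x|M. (cmod (f x))\<^sup>2)"
    proof (rule integral_mono)
      show "integrable M (\<lambda>x. indicator ((+) a0 ` padic_ball l) x * (cmod (v a0))\<^sup>2)"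
        using tiles_M[OF a0(1)]
        by (intro integrable_mult_left) (simp add: integrable_indicator_iff top.not_eq_extremum)
      show "integrable M (\<lambda>x. (cmod (f x))\<^sup>2)" using f2 by (simp add: L2_def)
      fix x
      show "indicator ((+) a0 ` padic_ball l) x * (cmod (v a0))\<^sup>2 \<le> (cmod (f x))\<^sup>2"
      proof (cases "x \<in> (+) a0 ` padic_ball l")
        case True
        have "x \<notin> (+) a ` padic_ball l" if "a \<in> A - {a0}" for a
          using padic_tiling_disjoint[OF A] a0 that True unfolding disjoint_family_on_def by blast
        hence "(\<Sum>a\<in>A - {a0}. v a * indicator ((+) a ` padic_ball l) x) = 0"
          by (intro sum.neutral ballI) (simp add: indicator_def)
        hence "f x = v a0"
          using True by (simp add: f_def sum.remove[OF finA a0(1)] indicator_def)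
        thus ?thesis using True by (simp add: indicator_def)
      qed (simp add: indicator_def)
    qed
    moreover have "(LINT x|M. indicator ((+) a0 ` padic_ball l) x * (cmod (v a0))\<^sup>2) =
        measure \<mu> (padic_ball l) * (cmod (v a0))\<^sup>2"
    proof -
      have "(LINT x|M. indicator ((+) a0 ` padic_ball l) x * (cmod (v a0))\<^sup>2) =
          measure M ((+) a0 ` padic_ball l) * (cmod (v a0))\<^sup>2"
        using sets.sets_into_space[OF tiles_M(1)[OF a0(1)]] by (simp add: Int_absorb2)
      also have "measure M ((+) a0 ` padic_ball l) = measure \<mu> (padic_ball l)"
        unfolding M_def measure_restrict_space[OF \<Omega>\<mu> sub[OF a0(1)]] by (rule haar_coset_measure[OF \<mu>])
      finally show ?thesis .
    qed
    ultimately have "measure \<mu> (padic_ball l) * (cmod (v a0))\<^sup>2 \<le> 0" by linarith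
    moreover have "measure \<mu> (padic_ball l) * (cmod (v a0))\<^sup>2 > 0"
      using a0(2) haar_ball_measure_pos[OF \<mu>, of l] by simp
    ultimately show False by simp
  qed
  have "\<exists>D. finite D \<and> card D = card A \<and> D \<subseteq> C"
  proof (cases "finite C")
    case True
    from obtain_subset_with_card_n[OF card_le[OF True]] show ?thesis by metis
  next
    case False
    thus ?thesis by (rule infinite_arbitrarily_large)
  qed
  thus ?thesis unfolding C_def by blast
qed

text \<open>
  The ball of index \<open>k\<close> is generated, as a group, by \<open>p\<^sup>k\<close> and the ball of index \<open>l\<close>. Hence a
  character that is trivial on the latter is determined on the former by its value at \<open>p\<^sup>k\<close>, which
  is a root of unity of order dividing \<open>p\<^sup>l\<^sup>-\<^sup>k\<close>; there are \<open>p\<^sup>l\<^sup>-\<^sup>k\<close> such roots.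
\<close>

lemma agreeing_characters_pigeonhole:
  fixes D :: "('p::prime_card padic \<Rightarrow> complex) set"
  assumes D: "finite D" "\<forall>\<psi>\<in>D. continuous_character \<psi>" "\<forall>\<psi>\<in>D. \<forall>h\<in>padic_ball l. \<psi> h = 1"
    and "k \<le> l" and large: "N * CARD('p) ^ nat (l - k) < card D"
  shows "\<exists>F\<subseteq>D. card F = Suc N \<and> (\<forall>\<psi>\<in>F. \<forall>\<phi>\<in>F. \<forall>h\<in>padic_ball k. \<psi> h = \<phi> h)"
proof -
  define d where "d = nat (l - k)"
  define n where "n = CARD('p) ^ d"
  define \<pi> :: "'p padic" where "\<pi> = of_nat CARD('p) powi k"
  \<comment> \<open>The possible values at \<open>\<pi>\<close> of a character that is trivial on the ball of index \<open>l\<close>.\<close>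
  define W where "W = {z :: complex. z ^ n = 1}"
  have l: "l = k + int d" using \<open>k \<le> l\<close> by (simp add: d_def)
  have p: "CARD('p) > 0" using prime_card_gt_1[where 'p='p] by linarith
  hence "n > 0" by (simp add: n_def)
  hence W: "finite W" "card W = n"
    unfolding W_def by (simp_all add: card_roots_unity_eq finite_roots_unity)
  have p0: "(of_nat CARD('p) :: 'p padic) \<noteq> 0"
  proof
    assume "(of_nat CARD('p) :: 'p padic) = 0"
    hence "1 / real CARD('p) = 0" using padic_norm_card[where 'p='p] by (simp only: padic_norm_0)
    thus False using p by simp
  qed
  have "\<pi> * of_nat n = of_nat CARD('p) powi l"
    using power_int_add[of "of_nat CARD('p) :: 'p padic" k "int d"] p0
    by (simp add: \<pi>_def n_def l)
  hence \<pi>n: "\<pi> * of_nat n \<in> padic_ball l"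
    by (simp add: padic_ball_def padic_norm_uniformizer_power)
  have root: "\<psi> \<pi> \<in> W" if "\<psi> \<in> D" for \<psi>
  proof -
    have "\<psi> \<pi> ^ n = \<psi> (\<pi> * of_nat n)" using D that by (simp add: continuous_character_of_nat)
    thus ?thesis using D \<pi>n that by (simp add: W_def)
  qed
  have agree: "\<psi> h = \<phi> h" if "\<psi> \<in> D" "\<phi> \<in> D" "\<psi> \<pi> = \<phi> \<pi>" and h: "h \<in> padic_ball k" for \<psi> \<phi> h
  proof -
    obtain z where z: "h = \<pi> * z" "z \<in> padic_integers"
      using h unfolding padic_ball_eq_image[of k, where 'p='p] \<pi>_def by blast
    obtain i where i: "z - of_nat i \<in> padic_ball (int d)"
      using padic_integer_residue[OF z(2), of "d"] by blast
    have "\<pi> * (z - of_nat i) \<in> padic_ball l"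
      unfolding \<pi>_def using i l padic_ball_mult_power_int[of k "z - of_nat i" "int d"] by simp
    hence mem: "h - \<pi> * of_nat i \<in> padic_ball l" by (simp add: z right_diff_distrib)
    have val: "\<theta> h = \<theta> \<pi> ^ i" if "\<theta> \<in> D" for \<theta>
    proof -
      have \<theta>: "continuous_character \<theta>" "\<theta> (h - \<pi> * of_nat i) = 1" using D mem that by blast+
      have "\<theta> h = \<theta> ((h - \<pi> * of_nat i) + \<pi> * of_nat i)" by simp
      also have "\<dots> = \<theta> \<pi> ^ i"
        by (simp only: continuous_character_add[OF \<theta>(1)] \<theta>(2) continuous_character_of_nat[OF \<theta>(1)] mult_1)
      finally show ?thesis .
    qed
    show ?thesis using val[OF that(1)] val[OF that(2)] that(3) by simp
  qed
  \<comment> \<open>Otherwise the at most \<open>n\<close> fibres of \<open>\<psi> \<mapsto> \<psi> \<pi>\<close> could not hold all of \<open>D\<close>.\<close>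
  have "\<exists>w\<in>W. N < card {\<psi>\<in>D. \<psi> \<pi> = w}"
  proof (rule ccontr)
    assume "\<not> ?thesis"
    hence le: "card {\<psi>\<in>D. \<psi> \<pi> = w} \<le> N" if "w \<in> W" for w using that by (simp add: not_less)
    have "card D = card (\<Union>w\<in>W. {\<psi>\<in>D. \<psi> \<pi> = w})" using root by (intro arg_cong[of _ _ card]) auto
    also have "\<dots> \<le> (\<Sum>w\<in>W. card {\<psi>\<in>D. \<psi> \<pi> = w})" by (rule card_UN_le[OF W(1)])
    also have "\<dots> \<le> (\<Sum>w\<in>W. N)" by (rule sum_mono[OF le])
    also have "\<dots> = N * n" using W by simp
    finally show False using large by (simp add: n_def d_def)
  qed
  then obtain w where "Suc N \<le> card {\<psi>\<in>D. \<psi> \<pi> = w}" by (auto simp: Suc_le_eq)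
  from obtain_subset_with_card_n[OF this]
  obtain F where F: "F \<subseteq> {\<psi>\<in>D. \<psi> \<pi> = w}" "card F = Suc N" .
  have "\<psi> h = \<phi> h" if "\<psi> \<in> F" "\<phi> \<in> F" "h \<in> padic_ball k" for \<psi> \<phi> h
  proof (rule agree)
    have "\<psi> \<in> {\<psi>\<in>D. \<psi> \<pi> = w}" "\<phi> \<in> {\<psi>\<in>D. \<psi> \<pi> = w}"
      using subsetD[OF F(1)] that by blast+
    thus "\<psi> \<in> D" "\<phi> \<in> D" "\<psi> \<pi> = \<phi> \<pi>" by simp_all
  qed (rule that)
  moreover have "F \<subseteq> D" using F(1) by blast
  ultimately show ?thesis using F(2) by blast
qed

lemma cmod_sum_unimodular_le:
  assumes "\<And>i. i \<in> F \<Longrightarrow> cmod (z i) = 1"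
  shows "(cmod (\<Sum>i\<in>F. c i * z i))\<^sup>2 \<le> real (card F) * (\<Sum>i\<in>F. (cmod (c i))\<^sup>2)"
proof -
  have "cmod (\<Sum>i\<in>F. c i * z i) \<le> (\<Sum>i\<in>F. cmod (c i) * 1)"
    using assms by (intro sum_norm_le) (simp add: norm_mult)
  hence "(cmod (\<Sum>i\<in>F. c i * z i))\<^sup>2 \<le> (\<Sum>i\<in>F. cmod (c i) * 1)\<^sup>2"
    by (intro power_mono) auto
  also have "\<dots> \<le> (\<Sum>i\<in>F. (cmod (c i))\<^sup>2) * (\<Sum>i\<in>F. 1\<^sup>2)"
    by (rule Cauchy_Schwarz_ineq_sum)
  finally show ?thesis by (simp add: mult.commute)
qed

text \<open>
  The characters in \<open>F\<close> share their restriction to the ball. On a tile of \<open>U\<close> a combination of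
  them is therefore its value at the tile's representative times this common restriction, and it
  vanishes on \<open>U\<close> as soon as it vanishes at the representatives. These are fewer conditions than
  there are characters in \<open>F\<close>.
\<close>

lemma dependent_characters_concentrate:
  fixes \<mu> :: "'p::prime_card padic measure"
  assumes \<mu>: "haar_measure \<mu>" and \<Omega>: "\<Omega> \<in> sets borel"
    and F: "\<forall>\<psi>\<in>F. continuous_character \<psi>" "card F = Suc (card B)"
    and agree: "\<forall>\<psi>\<in>F. \<forall>\<phi>\<in>F. \<forall>h\<in>padic_ball k. \<psi> h = \<phi> h"
    and B: "padic_tiling k B U"
    and R: "\<Omega> - U \<subseteq> padic_ball k"
  shows "\<exists>c. (\<exists>\<psi>\<in>F. c \<psi> \<noteq> 0) \<and>
    (L2_norm (restrict_space \<mu> \<Omega>) (\<lambda>x. \<Sum>\<psi>\<in>F. c \<psi> * \<psi> x))\<^sup>2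
      \<le> real (card F) * (\<Sum>\<psi>\<in>F. (cmod (c \<psi>))\<^sup>2) * measure \<mu> (\<Omega> - U)"
proof -
  have finF: "finite F" using F(2) by (metis card.infinite nat.distinct(1))
  have finB: "finite B" using B by (simp add: padic_tiling_def)
  have U: "U \<in> sets borel" by (rule padic_tiling_borel[OF B])
  have "card B < card F" using F by simp
  from homogeneous_system_nontrivial_solution[OF finB finF this, of "\<lambda>b \<psi>. \<psi> b"]
  obtain c where c: "\<exists>\<psi>\<in>F. c \<psi> \<noteq> 0" "\<forall>b\<in>B. (\<Sum>\<psi>\<in>F. c \<psi> * \<psi> b) = 0" by blast
  define g where "g x = (\<Sum>\<psi>\<in>F. c \<psi> * \<psi> x)" for x
  define S where "S = real (card F) * (\<Sum>\<psi>\<in>F. (cmod (c \<psi>))\<^sup>2)"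
  have S0: "S \<ge> 0" unfolding S_def by (intro mult_nonneg_nonneg sum_nonneg) auto
  obtain \<theta> where \<theta>: "\<theta> \<in> F" using c(1) by blast
  have g0: "g x = 0" if xU: "x \<in> U" for x
  proof -
    obtain b where b: "b \<in> B" "x - b \<in> padic_ball k"
      using xU unfolding padic_tiling_mem_iff[OF B] by blast
    have val: "\<psi> x = \<theta> (x - b) * \<psi> b" if "\<psi> \<in> F" for \<psi>
    proof -
      have "\<psi> ((x - b) + b) = \<psi> (x - b) * \<psi> b" using F(1) that by (intro continuous_character_add) blast
      moreover have "\<psi> (x - b) = \<theta> (x - b)" using agree that \<theta> b by blast
      ultimately show ?thesis by simp
    qed
    have "c \<psi> * \<psi> x = \<theta> (x - b) * (c \<psi> * \<psi> b)" if "\<psi> \<in> F" for \<psi>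
      unfolding val[OF that] by (rule mult.left_commute)
    hence "g x = (\<Sum>\<psi>\<in>F. \<theta> (x - b) * (c \<psi> * \<psi> b))"
      unfolding g_def by (intro sum.cong refl)
    also have "\<dots> = 0" using c(2) b(1) by (simp flip: sum_distrib_left)
    finally show ?thesis .
  qed
  have gS: "(cmod (g x))\<^sup>2 \<le> S" for x
    unfolding g_def S_def using F(1) by (intro cmod_sum_unimodular_le) (blast intro: continuous_character_norm)
  have \<Omega>\<mu>: "\<Omega> \<inter> space \<mu> \<in> sets \<mu>" using \<Omega> by (simp add: haar_sets[OF \<mu>] haar_space[OF \<mu>])
  have R_sets: "\<Omega> - U \<in> sets \<mu>" using \<Omega> U by (simp add: haar_sets[OF \<mu>])
  have "emeasure \<mu> (\<Omega> - U) \<le> emeasure \<mu> (padic_ball k)"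
    using R borel_open[OF padic_ball_open] by (intro emeasure_mono) (simp_all add: haar_sets[OF \<mu>])
  also have "\<dots> < \<infinity>" using haar_coset_finite[OF \<mu>, of 0 k] by simp
  finally have R_fin: "emeasure \<mu> (\<Omega> - U) < \<infinity>" .
  have int: "integrable \<mu> (\<lambda>x. indicator (\<Omega> - U) x * S)"
    using R_sets R_fin by (intro integrable_mult_left) (simp add: integrable_indicator_iff top.not_eq_extremum)
  have gm: "g \<in> borel_measurable borel"
    unfolding g_def[abs_def] using F(1)
    by (intro borel_measurable_sum borel_measurable_times borel_measurable_const continuous_character_measurable) blast
  have "(L2_norm (restrict_space \<mu> \<Omega>) g)\<^sup>2 = (LINT x|\<mu>. indicator \<Omega> x *\<^sub>R (cmod (g x))\<^sup>2)"
    unfolding L2_norm_squared by (rule integral_restrict_space[OF \<Omega>\<mu>])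
  also have "\<dots> \<le> (LINT x|\<mu>. indicator (\<Omega> - U) x * S)"
  proof (rule integral_mono')
    show "indicator \<Omega> x *\<^sub>R (cmod (g x))\<^sup>2 \<le> indicator (\<Omega> - U) x * S" for x
      using g0[of x] gS[of x] by (auto simp: indicator_def)
    show "0 \<le> indicator (\<Omega> - U) x * S" for x using S0 by simp
  qed (rule int)
  also have "\<dots> = S * measure \<mu> (\<Omega> - U)" by (simp add: haar_space[OF \<mu>])
  finally have "(L2_norm (restrict_space \<mu> \<Omega>) (\<lambda>x. \<Sum>\<psi>\<in>F. c \<psi> * \<psi> x))\<^sup>2 \<le> S * measure \<mu> (\<Omega> - U)"
    by (simp only: g_def[abs_def])
  thus ?thesis using c(1) unfolding S_def by blast
qed

section \<open>The union of shifted balls\<close>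

definition shifted_ball :: "int \<Rightarrow> 'p::prime_card padic set" where
  "shifted_ball j = (+) (of_nat CARD('p) powi (j - 1)) ` padic_ball j"

lemma shifted_ball_altdef:
  "{of_nat CARD('p) powi (j - 1) + of_nat CARD('p) powi j * z | z. z \<in> padic_integers}
    = (shifted_ball j :: 'p::prime_card padic set)"
  unfolding shifted_ball_def padic_ball_eq_image by (auto simp: image_image)

lemma shifted_ball_subset: "shifted_ball j \<subseteq> (padic_ball (j - 1) :: 'p::prime_card padic set)"
proof
  fix x :: "'p padic" assume "x \<in> shifted_ball j"
  hence "x - of_nat CARD('p) powi (j - 1) \<in> padic_ball j" unfolding shifted_ball_def mem_coset_iff .
  hence "x - of_nat CARD('p) powi (j - 1) \<in> padic_ball (j - 1)" by (rule padic_ball_mono[rotated]) simp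
  moreover have "(of_nat CARD('p) powi (j - 1) :: 'p padic) \<in> padic_ball (j - 1)"
    by (simp add: padic_ball_def padic_norm_uniformizer_power)
  ultimately have "(x - of_nat CARD('p) powi (j - 1)) + of_nat CARD('p) powi (j - 1) \<in> padic_ball (j - 1)"
    by (rule padic_ball_add)
  thus "x \<in> padic_ball (j - 1)" by simp
qed

text \<open>
  Points of \<open>shifted_ball j\<close> have norm exactly \<open>p\<^sup>1\<^sup>-\<^sup>j\<close>, just too large for the ball of index
  \<open>j\<close>. Together with the preceding inclusion this makes shifted balls of
  different indices disjoint.
\<close>

lemma shifted_ball_disjoint: "shifted_ball j \<inter> padic_ball j = ({} :: 'p::prime_card padic set)"
proof -
  have False if x: "x \<in> shifted_ball j" "x \<in> padic_ball j" for x :: "'p padic"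
  proof -
    have "x - of_nat CARD('p) powi (j - 1) \<in> padic_ball j" using x(1) unfolding shifted_ball_def mem_coset_iff .
    from padic_ball_diff[OF x(2) this] have "(of_nat CARD('p) powi (j - 1) :: 'p padic) \<in> padic_ball j" by simp
    hence "real CARD('p) powi (- (j - 1)) \<le> real CARD('p) powi (- j)"
      unfolding padic_ball_def mem_Collect_eq padic_norm_uniformizer_power .
    thus False using prime_card_gt_1[where 'p='p] by (simp only: power_int_le_iff)
  qed
  thus ?thesis by blast
qed

text \<open>
  Refining the given tiling multiplies the number of tiles by the index of the finer ball; the new
  shifted ball is one further tile. This extra tile is what the pigeonhole principle exploits.
\<close>

lemma shifted_balls_tiling_Suc:
  fixes m :: "nat \<Rightarrow> int" and A :: "'p::prime_card padic set"
  assumes m: "strict_mono_on {1..} m" and "n \<ge> 1"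
    and A: "padic_tiling (m n) A (\<Union>j\<in>{1..n}. shifted_ball (m j))"
  shows "\<exists>A' :: 'p padic set. padic_tiling (m (Suc n)) A' (\<Union>j\<in>{1..Suc n}. shifted_ball (m j)) \<and>
    card A' = Suc (card A * CARD('p) ^ nat (m (Suc n) - m n))"
proof -
  define U where "U = (\<Union>j\<in>{1..n}. shifted_ball (m j) :: 'p padic set)"
  define b :: "'p padic" where "b = of_nat CARD('p) powi (m (Suc n) - 1)"
  have less: "m n < m (Suc n)" using m \<open>n \<ge> 1\<close> by (simp add: strict_mono_on_def)
  obtain A1 where A1: "padic_tiling (m (Suc n)) A1 U" "card A1 = card A * CARD('p) ^ nat (m (Suc n) - m n)"
    using padic_tiling_refine[OF A, of "m (Suc n)"] less unfolding U_def by auto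
  have last: "padic_tiling (m (Suc n)) {b} (shifted_ball (m (Suc n)))"
    unfolding shifted_ball_def b_def by (rule padic_tiling_coset)
  have disj: "U \<inter> shifted_ball (m (Suc n)) = {}"
  proof -
    have False if x: "x \<in> shifted_ball (m j)" "j \<in> {1..n}" "x \<in> shifted_ball (m (Suc n))" for x :: "'p padic" and j
    proof -
      have "m j < m (Suc n)" using m x(2) by (simp add: strict_mono_on_def)
      hence "m j \<le> m (Suc n) - 1" by simp
      moreover have "x \<in> padic_ball (m (Suc n) - 1)" using x(3) shifted_ball_subset by blast
      ultimately have "x \<in> padic_ball (m j)" by (rule padic_ball_mono)
      thus False using x(1) shifted_ball_disjoint by blast
    qed
    thus ?thesis unfolding U_def by blast
  qed
  have "card (A1 \<union> {b}) = Suc (card A1)"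
    using padic_tiling_union(2)[OF A1(1) last disj] A1(1) by (simp add: padic_tiling_def)
  moreover have "U \<union> shifted_ball (m (Suc n)) = (\<Union>j\<in>{1..Suc n}. shifted_ball (m j))"
    unfolding U_def using \<open>n \<ge> 1\<close> by (simp add: atLeastAtMostSuc_conv Un_commute)
  ultimately show ?thesis using padic_tiling_union(1)[OF A1(1) last disj] A1(2)
    by (intro exI[of _ "A1 \<union> {b}"]) simp
qed

lemma shifted_balls_tiling:
  fixes m :: "nat \<Rightarrow> int"
  assumes m: "strict_mono_on {1..} m" and "n \<ge> 1"
  shows "\<exists>A :: 'p::prime_card padic set.
    padic_tiling (m n) A (\<Union>j\<in>{1..n}. shifted_ball (m j)) \<and> card A > 0"
  using \<open>n \<ge> 1\<close>
proof (induction n rule: nat_induct_at_least)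
  case base
  show ?case using padic_tiling_coset[of "m 1" "of_nat CARD('p) powi (m 1 - 1) :: 'p padic"]
    by (intro exI[of _ "{of_nat CARD('p) powi (m 1 - 1)}"]) (simp add: shifted_ball_def)
next
  case (Suc n)
  then obtain A :: "'p padic set" where "padic_tiling (m n) A (\<Union>j\<in>{1..n}. shifted_ball (m j))" by blast
  from shifted_balls_tiling_Suc[OF m Suc.hyps this] show ?case by (metis zero_less_Suc)
qed

section \<open>Nonexistence of a Riesz basis of characters\<close>

text \<open>
  The constant is \<open>2 K L\<close>, where \<open>K\<close> comes from the lower Riesz bound, \<open>L\<close> is the measure of a
  ball containing the whole set, and the factor 2 absorbs the passage from \<open>N\<close> to \<open>N + 1\<close>
  characters.
\<close>

lemma Riesz_basis_shifted_balls_gap_bound: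
  fixes m :: "nat \<Rightarrow> int" and \<mu> :: "'p::prime_card padic measure"
  assumes \<mu>: "haar_measure \<mu>" and m: "strict_mono_on {1..} m"
    and \<Omega>_def: "\<Omega> = (\<Union>n\<in>{1..}. shifted_ball (m n))"
    and X: "\<forall>\<psi>\<in>X. continuous_character \<psi>"
    and basis: "L2_Riesz_basis (restrict_space \<mu> \<Omega>) X (\<lambda>\<psi>. \<psi>)"
  shows "\<exists>C. \<forall>n\<ge>1. real CARD('p) ^ nat (m (Suc n) - m n - 1) \<le> C"
proof -
  define L where "L = measure \<mu> (padic_ball (m 1 - 1))"
  obtain K where K: "K > 0" "\<And>J c. finite J \<Longrightarrow> J \<subseteq> X \<Longrightarrow> (\<Sum>\<psi>\<in>J. (cmod (c \<psi>))\<^sup>2) \<le>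
      K * (L2_norm (restrict_space \<mu> \<Omega>) (\<lambda>x. \<Sum>\<psi>\<in>J. c \<psi> * \<psi> x))\<^sup>2"
    using L2_Riesz_basis_lower_bound[OF basis] by blast
  have "open (shifted_ball j :: 'p padic set)" for j
    unfolding shifted_ball_def by (rule padic_coset_open)
  hence "open \<Omega>" unfolding \<Omega>_def by blast
  hence \<Omega>: "\<Omega> \<in> sets borel" by (rule borel_open)
  have ball: "(padic_ball k :: 'p padic set) \<in> sets \<mu>" "emeasure \<mu> (padic_ball k) \<noteq> \<infinity>" for k
    using borel_open[OF padic_ball_open] haar_measure_compact[OF \<mu> compact_padic_ball, of k]
    by (simp_all add: haar_sets[OF \<mu>])
  have mono: "m i \<le> m j" if "1 \<le> i" "i \<le> j" for i j
    using m that strict_mono_on_leD[OF m, of i j] by simp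
  have tail: "shifted_ball (m j) \<subseteq> (padic_ball (m i - 1) :: 'p padic set)" if "1 \<le> i" "i \<le> j" for i j
  proof
    fix x :: "'p padic" assume "x \<in> shifted_ball (m j)"
    hence "x \<in> padic_ball (m j - 1)" using shifted_ball_subset by blast
    thus "x \<in> padic_ball (m i - 1)" by (rule padic_ball_mono[rotated]) (use mono[OF that] in simp)
  qed
  have "real CARD('p) ^ nat (m (Suc n) - m n - 1) \<le> 2 * K * L" if n: "n \<ge> 1" for n
  proof -
    define k where "k = m n"
    define l where "l = m (Suc n)"
    define U where "U = (\<Union>j\<in>{1..n}. shifted_ball (m j) :: 'p padic set)"
    define V where "V = (\<Union>j\<in>{1..Suc n}. shifted_ball (m j) :: 'p padic set)"
    have kl: "k < l" using m n by (simp add: k_def l_def strict_mono_on_def)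
    obtain B where B: "padic_tiling k B U" "card B > 0"
      using shifted_balls_tiling[OF m n, where 'p='p] unfolding k_def U_def by blast
    obtain A where A: "padic_tiling l A V" "card A = Suc (card B * CARD('p) ^ nat (l - k))"
      using shifted_balls_tiling_Suc[OF m n B(1)[unfolded k_def U_def]] unfolding k_def l_def V_def by blast
    have UV: "U \<subseteq> \<Omega>" "V \<subseteq> \<Omega>" unfolding U_def V_def \<Omega>_def by auto
    have rest: "\<Omega> - U \<subseteq> padic_ball (l - 1)"
    proof
      fix x assume "x \<in> \<Omega> - U"
      then obtain j where j: "1 \<le> j" "x \<in> shifted_ball (m j)" "j \<notin> {1..n}"
        unfolding \<Omega>_def U_def by auto
      hence "Suc n \<le> j" by simp
      from subsetD[OF tail[OF _ this] j(2)] show "x \<in> padic_ball (l - 1)" by (simp add: l_def)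
    qed
    hence restk: "\<Omega> - U \<subseteq> padic_ball k"
    proof (rule order_trans)
      show "padic_ball (l - 1) \<subseteq> (padic_ball k :: 'p padic set)"
        using padic_ball_mono[of k "l - 1"] kl by (intro subsetI) simp
    qed
    obtain D where D: "D \<subseteq> X" "finite D" "card D = card A" "\<forall>\<psi>\<in>D. \<forall>h\<in>padic_ball l. \<psi> h = 1"
      using Riesz_basis_trivial_characters[OF \<mu> \<Omega> X basis A(1) UV(2)] by blast
    have "card B * CARD('p) ^ nat (l - k) < card D" using D A by simp
    moreover have "\<forall>\<psi>\<in>D. continuous_character \<psi>" using D X by blast
    ultimately obtain F where F: "F \<subseteq> D" "card F = Suc (card B)"
      "\<forall>\<psi>\<in>F. \<forall>\<phi>\<in>F. \<forall>h\<in>padic_ball k. \<psi> h = \<phi> h"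
      using agreeing_characters_pigeonhole[OF D(2) _ D(4), of k "card B"] kl by auto
    have FX: "F \<subseteq> X" "finite F" using F D by (auto intro: finite_subset)
    have "\<forall>\<psi>\<in>F. continuous_character \<psi>" using FX X by blast
    from dependent_characters_concentrate[OF \<mu> \<Omega> this F(2,3) B(1) restk] obtain c where
      c: "\<exists>\<psi>\<in>F. c \<psi> \<noteq> 0" and conc: "(L2_norm (restrict_space \<mu> \<Omega>) (\<lambda>x. \<Sum>\<psi>\<in>F. c \<psi> * \<psi> x))\<^sup>2
      \<le> real (card F) * (\<Sum>\<psi>\<in>F. (cmod (c \<psi>))\<^sup>2) * measure \<mu> (\<Omega> - U)" by blast
    define S where "S = (\<Sum>\<psi>\<in>F. (cmod (c \<psi>))\<^sup>2)"
    have "S > 0"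
    proof -
      obtain \<psi> where \<psi>: "\<psi> \<in> F" "c \<psi> \<noteq> 0" using c by blast
      hence "0 < (cmod (c \<psi>))\<^sup>2" by simp
      also have "\<dots> \<le> S" unfolding S_def using \<psi> FX by (intro member_le_sum) auto
      finally show ?thesis .
    qed
    have "S \<le> K * (real (card F) * S * measure \<mu> (\<Omega> - U))"
      using K(2)[OF FX(2,1), of c] mult_left_mono[OF conc, of K] K(1) unfolding S_def by linarith
    hence "1 * S \<le> (K * (real (card F) * measure \<mu> (\<Omega> - U))) * S" by (simp add: mult_ac)
    hence "1 \<le> K * (real (card F) * measure \<mu> (\<Omega> - U))" using \<open>S > 0\<close> mult_le_cancel_right_pos by blast
    also have "\<dots> \<le> K * ((2 * real (card B)) * measure \<mu> (padic_ball (l - 1)))"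
    proof (intro mult_left_mono mult_mono)
      show "measure \<mu> (\<Omega> - U) \<le> measure \<mu> (padic_ball (l - 1))"
        using ball[of "l - 1"] rest \<Omega> padic_tiling_borel[OF B(1)]
        by (intro measure_mono_fmeasurable) (auto simp: haar_sets[OF \<mu>] fmeasurable_def top.not_eq_extremum)
    qed (use B F K in auto)
    finally have 1: "1 \<le> K * ((2 * real (card B)) * measure \<mu> (padic_ball (l - 1)))" .
    have "nat (l - 1 - k) = nat (m (Suc n) - m n - 1)" by (simp add: k_def l_def algebra_simps)
    hence ratio: "measure \<mu> (padic_ball k) = real CARD('p) ^ nat (m (Suc n) - m n - 1) * measure \<mu> (padic_ball (l - 1))"
      using haar_ball_measure_ratio[OF \<mu>, of k "l - 1"] kl by simp
    have "real (card B) * measure \<mu> (padic_ball k) = measure \<mu> U"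
      using haar_tiling_measure[OF \<mu> B(1)] by simp
    also have "\<dots> \<le> L"
      unfolding L_def
    proof (rule measure_mono_fmeasurable)
      show "U \<subseteq> padic_ball (m 1 - 1)" unfolding U_def by (rule UN_least) (rule tail, auto)
      show "U \<in> sets \<mu>" using padic_tiling_borel[OF B(1)] by (simp add: haar_sets[OF \<mu>])
      show "padic_ball (m 1 - 1) \<in> fmeasurable \<mu>"
        using ball by (simp add: fmeasurable_def top.not_eq_extremum)
    qed
    finally have 2: "real (card B) * measure \<mu> (padic_ball k) \<le> L" .
    have "real CARD('p) ^ nat (m (Suc n) - m n - 1) * 1 \<le> real CARD('p) ^ nat (m (Suc n) - m n - 1) *
        (K * ((2 * real (card B)) * measure \<mu> (padic_ball (l - 1))))"
      by (intro mult_left_mono 1) simp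
    also have "\<dots> = 2 * K * (real (card B) * measure \<mu> (padic_ball k))"
      unfolding ratio by (simp add: mult_ac)
    also have "\<dots> \<le> 2 * K * L" using 2 K(1) by (intro mult_left_mono) auto
    finally show ?thesis by simp
  qed
  thus ?thesis by blast
qed

theorem corollary1p6:
  fixes m :: "nat \<Rightarrow> int"
    and p :: nat
    and \<Omega> :: "'p::prime_card padic set"
    and \<mu> :: "'p padic measure"
  assumes "p = CARD('p)"
    and "strict_mono_on {1..} m"
    and "limsup (\<lambda>n. ereal (of_int (m (Suc n) - m n))) = \<infinity>"
    and "\<Omega> = (\<Union>n\<in>{1..}. {of_nat p powi (m n - 1) + of_nat p powi (m n) * z | z. z \<in> padic_integers})"
    and "haar_measure \<mu>"
  shows "\<not> (\<exists>X. (\<forall>\<psi>\<in>X. continuous_character \<psi>) \<and>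
              L2_Riesz_basis (restrict_space \<mu> \<Omega>) X (\<lambda>\<psi>. \<psi>))"
proof
  assume "\<exists>X. (\<forall>\<psi>\<in>X. continuous_character \<psi>) \<and> L2_Riesz_basis (restrict_space \<mu> \<Omega>) X (\<lambda>\<psi>. \<psi>)"
  then obtain X where X: "\<forall>\<psi>\<in>X. continuous_character \<psi>"
    and basis: "L2_Riesz_basis (restrict_space \<mu> \<Omega>) X (\<lambda>\<psi>. \<psi>)" by blast
  have \<Omega>: "\<Omega> = (\<Union>n\<in>{1..}. shifted_ball (m n))"
    using assms(4) unfolding assms(1) shifted_ball_altdef .
  obtain C where C: "\<And>n. n \<ge> 1 \<Longrightarrow> real CARD('p) ^ nat (m (Suc n) - m n - 1) \<le> C"
    using Riesz_basis_shifted_balls_gap_bound[OF assms(5,2) \<Omega> X basis] by blast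
  have "real_of_int (m (Suc n) - m n) \<le> C + 1" if n: "n \<ge> 1" for n
  proof -
    define d where "d = nat (m (Suc n) - m n - 1)"
    have "m n < m (Suc n)" using assms(2) n by (simp add: strict_mono_on_def)
    hence d: "real_of_int (m (Suc n) - m n) = real d + 1" by (simp add: d_def)
    \<comment> \<open>A bound on \<open>p ^ d\<close> bounds \<open>d\<close> itself.\<close>
    have "real d < 2 ^ d" by (rule of_nat_less_two_power)
    also have "(2 :: real) ^ d \<le> real CARD('p) ^ d"
      using prime_card_gt_1[where 'p='p] by (intro power_mono) auto
    also have "\<dots> \<le> C" unfolding d_def by (rule C[OF n])
    finally show ?thesis using d by simp
  qed
  hence "\<forall>\<^sub>F n in sequentially. ereal (of_int (m (Suc n) - m n)) \<le> ereal (C + 1)"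
    unfolding eventually_sequentially by (intro exI[of _ 1]) simp
  hence "limsup (\<lambda>n. ereal (of_int (m (Suc n) - m n))) \<le> ereal (C + 1)"
    by (rule Limsup_bounded)
  with assms(3) show False by simp
qed

end
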